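(* Let $R$ be a commutative unital ring and let $M$ be an $R$-module with small Jacobson radical (special case: $M$ is finitely generated) and finite dual Goldie dimension. Let $S_M$ denote the set of maximal ideals $\mathfrak{m}$ of $R$ such that $\dim_{R/\mathfrak{m}}(M/\mathfrak{m}M)\geq 2$. If $S_M=\emptyset$ and $M$ is finitely generated, then $M$ is cyclic, and hence cannot be covered by proper submodules. Else, if $S_M\neq\emptyset$, then $\sigma(M,R)=\min_{\mathfrak{m}\in S_M}|R/\mathfrak{m}|+1$.
   Context: $\sigma(M,R)$ (the covering number) is the minimum cardinal number of proper $R$-submodules of $M$ whose union is $M$. A submodule $N$ of $M$ is small if for every submodule $K$ of $M$, $N+K=M$ implies $K=M$. The Jacobson radical $\mathrm{J}(M)$ is the intersection of all maximal submodules of $M$ (a submodule $N$ is maximal if $M/N$ is simple; the intersection is $M$ if there are none). "Small Jacobson radical" means that $\mathrm{J}(M)$ is a small submodule of $M$. The dual Goldie dimension (also called hollow dimension or corank) of $M$ is the supremum of the integers $n\ge 0$ for which there exists a surjective $R$-linear map from $M$ onto a direct product $N_1\times\cdots\times N_n$ of $n$ nonzero $R$-modules (it is $0$ if $M=0$). *)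

theory Defs
  imports
    "Jordan_Normal_Form.Missing_VectorSpace"
    "HOL-Algebra.QuotRing"
    "HOL-Library.Extended_Nat"
begin

text \<open>
  Modules are those of \<open>HOL-Algebra.Module\<close>; submodules, spans, linear maps and dimension are those
  of \<open>VectorSpace\<close>. Some names are qualified because \<open>HOL.Modules\<close> and \<open>HOL-Algebra.Module\<close> also
  provide a \<open>module\<close>, respectively a \<open>submodule\<close>.
\<close>

subsection \<open>Quotient modules\<close>

text \<open>
  The scalar multiplication follows the pattern of \<^const>\<open>rcoset_mult\<close> in \<^const>\<open>FactRing\<close>: the
  union is over a family of equal cosets. The multiplicative fields of a module record carry no
  meaning.
\<close>

definition quot_module ::
  "('r, 'm, 'l) module_scheme \<Rightarrow> 'm set \<Rightarrow> ('r, 'm set) module" where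
  "quot_module M N =
    \<lparr>carrier = a_rcosets\<^bsub>M\<^esub> N, mult = undefined, one = undefined, zero = N, add = set_add M,
     smult = (\<lambda>r X. \<Union>x\<in>X. N +>\<^bsub>M\<^esub> (r \<odot>\<^bsub>M\<^esub> x))\<rparr>"

definition ideal_mult ::
  "('r, 'k) ring_scheme \<Rightarrow> ('r, 'm, 'l) module_scheme \<Rightarrow> 'r set \<Rightarrow> 'm set" where
  "ideal_mult R M I = LinearCombinations.module.span R M {a \<odot>\<^bsub>M\<^esub> x |a x. a \<in> I \<and> x \<in> carrier M}"

text \<open>\<open>M/IM\<close> as a module over \<open>R/I\<close>: the same group as \<open>quot_module M (ideal_mult R M I)\<close>, with
  cosets of \<open>I\<close> as scalars.\<close>

definition quot_by_ideal ::
  "('r, 'k) ring_scheme \<Rightarrow> ('r, 'm, 'l) module_scheme \<Rightarrow> 'r set \<Rightarrow> ('r set, 'm set) module" where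
  "quot_by_ideal R M I =
    \<lparr>carrier = a_rcosets\<^bsub>M\<^esub> (ideal_mult R M I), mult = undefined, one = undefined,
     zero = ideal_mult R M I, add = set_add M,
     smult = (\<lambda>A X. \<Union>a\<in>A. \<Union>x\<in>X. ideal_mult R M I +>\<^bsub>M\<^esub> (a \<odot>\<^bsub>M\<^esub> x))\<rparr>"

subsection \<open>Jacobson radical\<close>

definition simple_module :: "('r, 'k) ring_scheme \<Rightarrow> ('r, 'm, 'l) module_scheme \<Rightarrow> bool" where
  "simple_module R M \<longleftrightarrow>
    Module.module R M \<and> carrier M \<noteq> {\<zero>\<^bsub>M\<^esub>} \<and>
    (\<forall>N. LinearCombinations.submodule R N M \<longrightarrow> N = {\<zero>\<^bsub>M\<^esub>} \<or> N = carrier M)"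

definition maximal_submodule ::
  "('r, 'k) ring_scheme \<Rightarrow> ('r, 'm, 'l) module_scheme \<Rightarrow> 'm set \<Rightarrow> bool" where
  "maximal_submodule R M N \<longleftrightarrow>
    LinearCombinations.submodule R N M \<and> simple_module R (quot_module M N)"

definition jacobson_radical ::
  "('r, 'k) ring_scheme \<Rightarrow> ('r, 'm, 'l) module_scheme \<Rightarrow> 'm set" where
  "jacobson_radical R M = carrier M \<inter> \<Inter> {N. maximal_submodule R M N}"

definition small_submodule ::
  "('r, 'k) ring_scheme \<Rightarrow> ('r, 'm, 'l) module_scheme \<Rightarrow> 'm set \<Rightarrow> bool" where
  "small_submodule R M N \<longleftrightarrow>
    LinearCombinations.submodule R N M \<and>
    (\<forall>K. LinearCombinations.submodule R K M \<longrightarrow> N <+>\<^bsub>M\<^esub> K = carrier M \<longrightarrow> K = carrier M)"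

subsection \<open>Generators\<close>

definition finitely_generated :: "('r, 'k) ring_scheme \<Rightarrow> ('r, 'm, 'l) module_scheme \<Rightarrow> bool" where
  "finitely_generated R M \<longleftrightarrow>
    (\<exists>A. finite A \<and> A \<subseteq> carrier M \<and> LinearCombinations.module.span R M A = carrier M)"

definition cyclic_module :: "('r, 'k) ring_scheme \<Rightarrow> ('r, 'm, 'l) module_scheme \<Rightarrow> bool" where
  "cyclic_module R M \<longleftrightarrow> (\<exists>x\<in>carrier M. carrier M = {r \<odot>\<^bsub>M\<^esub> x |r. r \<in> carrier R})"

subsection \<open>Dual Goldie dimension\<close>

definition product_module :: "'i set \<Rightarrow> ('i \<Rightarrow> ('r, 'm, 'l) module_scheme) \<Rightarrow> ('r, 'i \<Rightarrow> 'm) module" where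
  "product_module I N =
    \<lparr>carrier = (\<Pi>\<^sub>E i\<in>I. carrier (N i)), mult = undefined, one = undefined,
     zero = (\<lambda>i\<in>I. \<zero>\<^bsub>N i\<^esub>), add = (\<lambda>f g. \<lambda>i\<in>I. f i \<oplus>\<^bsub>N i\<^esub> g i),
     smult = (\<lambda>r f. \<lambda>i\<in>I. r \<odot>\<^bsub>N i\<^esub> f i)\<rparr>"

text \<open>
  The factors range over modules whose elements have type \<^typ>\<open>'m set\<close>. This loses nothing: every
  factor of a product onto which \<open>M\<close> maps is an image of \<open>M\<close>, hence isomorphic to a
  \<^const>\<open>quot_module\<close> of \<open>M\<close>, whose elements have that type.
\<close>

definition maps_onto_product ::
  "('r, 'k) ring_scheme \<Rightarrow> ('r, 'm, 'l) module_scheme \<Rightarrow> nat \<Rightarrow> bool" where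
  "maps_onto_product R M n \<longleftrightarrow>
    (\<exists>(N :: nat \<Rightarrow> ('r, 'm set) module) f.
      (\<forall>i<n. Module.module R (N i) \<and> carrier (N i) \<noteq> {\<zero>\<^bsub>N i\<^esub>}) \<and>
      f \<in> LinearCombinations.module_hom R M (product_module {..<n} N) \<and>
      f ` carrier M = carrier (product_module {..<n} N))"

definition dual_goldie_dim :: "('r, 'k) ring_scheme \<Rightarrow> ('r, 'm, 'l) module_scheme \<Rightarrow> enat" where
  "dual_goldie_dim R M = Sup (enat ` {n. maps_onto_product R M n})"

subsection \<open>Covering number\<close>

unbundle cardinal_syntax

text \<open>The least cardinality of a member of \<open>\<A>\<close>; only meaningful when \<open>\<A>\<close> is nonempty.\<close>

definition min_card :: "'a set set \<Rightarrow> 'a rel" where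
  "min_card \<A> = |SOME A. A \<in> \<A> \<and> (\<forall>B\<in>\<A>. |A| \<le>o |B| )|"

lemma min_card:
  assumes "\<A> \<noteq> {}"
  shows "\<exists>A\<in>\<A>. min_card \<A> = |A| \<and> (\<forall>B\<in>\<A>. |A| \<le>o |B| )"
proof -
  have "\<exists>r\<in>card_of ` \<A>. \<forall>r'\<in>card_of ` \<A>. r \<le>o r'"
    using assms by (intro exists_minim_Card_order) (auto simp: card_of_Card_order)
  then have "\<exists>A. A \<in> \<A> \<and> (\<forall>B\<in>\<A>. |A| \<le>o |B| )" by auto
  from someI_ex[OF this] show ?thesis unfolding min_card_def by blast
qed

definition submodule_covers ::
  "('r, 'k) ring_scheme \<Rightarrow> ('r, 'm, 'l) module_scheme \<Rightarrow> 'm set set set" where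
  "submodule_covers R M =
    {\<C>. (\<forall>N\<in>\<C>. LinearCombinations.submodule R N M \<and> N \<noteq> carrier M) \<and> \<Union>\<C> = carrier M}"

definition covering_number ::
  "('r, 'k) ring_scheme \<Rightarrow> ('r, 'm, 'l) module_scheme \<Rightarrow> 'm set rel" where
  "covering_number R M = min_card (submodule_covers R M)"

subsection \<open>The set \<open>S\<^sub>M\<close>\<close>

text \<open>\<^const>\<open>vectorspace.dim\<close> is only meaningful for finite-dimensional spaces, so the
  infinite-dimensional case is listed separately.\<close>

definition noncyclic_maximal_ideals ::
  "('r, 'k) ring_scheme \<Rightarrow> ('r, 'm, 'l) module_scheme \<Rightarrow> 'r set set" where
  "noncyclic_maximal_ideals R M =
    {\<mm>. maximalideal \<mm> R \<and>
         (\<not> vectorspace.fin_dim (R Quot \<mm>) (quot_by_ideal R M \<mm>) \<or>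
          2 \<le> vectorspace.dim (R Quot \<mm>) (quot_by_ideal R M \<mm>))}"

subsection \<open>Well-formedness of the quotients, and finitely generated modules\<close>

context
  fixes R :: "('r, 'k) ring_scheme" and M :: "('r, 'm, 'l) module_scheme" and N
  assumes M: "Module.module R M" and N: "LinearCombinations.submodule R N M"
begin

interpretation Module.module R M by (rule M)
interpretation N: LinearCombinations.submodule R N M by (rule N)

lemma submodule_abelian_subgroup: "abelian_subgroup N M"
proof (rule abelian_subgroupI3)
  show "additive_subgroup N M"
  proof (rule additive_subgroup.intro, rule M.add.subgroupI)
    show "N \<subseteq> carrier M" by (rule N.subset)
    show "N \<noteq> {}" by (metis N.zero_closed empty_iff)
    fix a assume a: "a \<in> N"
    then have "\<ominus>\<^bsub>M\<^esub> a = (\<ominus>\<^bsub>R\<^esub> \<one>\<^bsub>R\<^esub>) \<odot>\<^bsub>M\<^esub> a" using N.subset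
      by (metis R.one_closed smult_l_minus smult_one subset_iff)
    then show "\<ominus>\<^bsub>M\<^esub> a \<in> N" using a N.smult_closed by auto
  qed (use N.m_closed in auto)
qed (rule M.abelian_group_axioms)

interpretation A: abelian_subgroup N M by (rule submodule_abelian_subgroup)

lemma submodule_coset_eq: "x \<in> carrier M \<Longrightarrow> y \<in> N +>\<^bsub>M\<^esub> x \<Longrightarrow> N +>\<^bsub>M\<^esub> y = N +>\<^bsub>M\<^esub> x"
  by (metis A.a_repr_independence')

lemma submodule_smult_coset:
  assumes "r \<in> carrier R" "y \<in> carrier M" "x \<in> N +>\<^bsub>M\<^esub> y"
  shows "N +>\<^bsub>M\<^esub> (r \<odot>\<^bsub>M\<^esub> x) = N +>\<^bsub>M\<^esub> (r \<odot>\<^bsub>M\<^esub> y)"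
proof (rule submodule_coset_eq)
  obtain n where n: "n \<in> N" "x = n \<oplus>\<^bsub>M\<^esub> y" using assms(3) unfolding a_r_coset_def' by auto
  then have "r \<odot>\<^bsub>M\<^esub> x = r \<odot>\<^bsub>M\<^esub> n \<oplus>\<^bsub>M\<^esub> r \<odot>\<^bsub>M\<^esub> y" using assms N.subset smult_r_distr by auto
  then show "r \<odot>\<^bsub>M\<^esub> x \<in> N +>\<^bsub>M\<^esub> (r \<odot>\<^bsub>M\<^esub> y)" using n N.smult_closed[OF assms(1)] unfolding a_r_coset_def' by auto
qed (use assms in auto)

lemma submodule_mem_coset: "x \<in> carrier M \<Longrightarrow> x \<in> N +>\<^bsub>M\<^esub> x"
  by (rule A.a_rcos_self)

lemma UN_smult_coset:
  assumes "r \<in> carrier R" "y \<in> carrier M"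
  shows "(\<Union>x\<in>N +>\<^bsub>M\<^esub> y. N +>\<^bsub>M\<^esub> (r \<odot>\<^bsub>M\<^esub> x)) = N +>\<^bsub>M\<^esub> (r \<odot>\<^bsub>M\<^esub> y)"
  by (rule UN_constant_eq[OF submodule_mem_coset[OF assms(2)]]) (intro ballI submodule_smult_coset[OF assms])

lemma submodule_a_rcosets_iff: "X \<in> a_rcosets\<^bsub>M\<^esub> N \<longleftrightarrow> (\<exists>x\<in>carrier M. X = N +>\<^bsub>M\<^esub> x)"
  unfolding A_RCOSETS_def' by auto

lemma quot_abelian_group:
  fixes Q :: "('a, 'm set) module"
  assumes "carrier Q = a_rcosets\<^bsub>M\<^esub> N" "zero Q = N" "add Q = set_add M"
  shows "abelian_group Q"
proof -
  have z: "N = N +>\<^bsub>M\<^esub> \<zero>\<^bsub>M\<^esub>" by (rule A.a_rcos_const[symmetric]) simp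
  have c: "X \<in> carrier Q \<longleftrightarrow> (\<exists>x\<in>carrier M. X = N +>\<^bsub>M\<^esub> x)" for X
    by (simp add: assms submodule_a_rcosets_iff)
  have z': "\<zero>\<^bsub>Q\<^esub> = N +>\<^bsub>M\<^esub> \<zero>\<^bsub>M\<^esub>" by (rule trans[OF assms(2) z])
  have p: "x \<in> carrier M \<Longrightarrow> y \<in> carrier M \<Longrightarrow> (N +>\<^bsub>M\<^esub> x) \<oplus>\<^bsub>Q\<^esub> (N +>\<^bsub>M\<^esub> y) = N +>\<^bsub>M\<^esub> (x \<oplus>\<^bsub>M\<^esub> y)" for x y
    by (simp add: assms A.a_rcos_sum)
  have inv: "\<exists>y\<in>carrier Q. y \<oplus>\<^bsub>Q\<^esub> X = \<zero>\<^bsub>Q\<^esub>" if X: "X \<in> carrier Q" for X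
  proof -
    obtain x where x: "x \<in> carrier M" "X = N +>\<^bsub>M\<^esub> x" using X unfolding c by blast
    have "(N +>\<^bsub>M\<^esub> (\<ominus>\<^bsub>M\<^esub> x)) \<oplus>\<^bsub>Q\<^esub> X = \<zero>\<^bsub>Q\<^esub>"
      unfolding x(2) z' using x(1) by (subst p) (simp_all add: M.l_neg)
    moreover have "N +>\<^bsub>M\<^esub> (\<ominus>\<^bsub>M\<^esub> x) \<in> carrier Q" unfolding c using x(1) by blast
    ultimately show ?thesis by blast
  qed
  show ?thesis
    apply (rule abelian_groupI)
    subgoal by (auto simp: c p)
    subgoal unfolding c z' by blast
    subgoal by (auto simp: c p M.a_assoc)
    subgoal by (auto simp: c p M.a_comm)
    subgoal by (auto simp: c p z')
    subgoal by (rule inv)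
    done
qed

lemma quot_module_smult:
  "r \<in> carrier R \<Longrightarrow> y \<in> carrier M \<Longrightarrow> r \<odot>\<^bsub>quot_module M N\<^esub> (N +>\<^bsub>M\<^esub> y) = N +>\<^bsub>M\<^esub> (r \<odot>\<^bsub>M\<^esub> y)"
  by (simp add: quot_module_def UN_smult_coset)

lemma quot_module_add:
  "x \<in> carrier M \<Longrightarrow> y \<in> carrier M \<Longrightarrow> (N +>\<^bsub>M\<^esub> x) \<oplus>\<^bsub>quot_module M N\<^esub> (N +>\<^bsub>M\<^esub> y) = N +>\<^bsub>M\<^esub> (x \<oplus>\<^bsub>M\<^esub> y)"
  by (simp add: quot_module_def A.a_rcos_sum)

lemma quot_module_carrier:
  "X \<in> carrier (quot_module M N) \<longleftrightarrow> (\<exists>x\<in>carrier M. X = N +>\<^bsub>M\<^esub> x)"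
  by (simp add: quot_module_def submodule_a_rcosets_iff)

lemma quot_module_is_module: "Module.module R (quot_module M N)"
proof (rule moduleI)
  show "cring R" ..
  show "abelian_group (quot_module M N)" by (rule quot_abelian_group) (auto simp: quot_module_def)
qed (auto simp: quot_module_carrier quot_module_smult quot_module_add smult_l_distr smult_r_distr smult_assoc1)

end

context
  fixes R :: "('r, 'k) ring_scheme" and M :: "('r, 'm, 'l) module_scheme" and I
  assumes M: "Module.module R M" and I: "ideal I R"
begin

interpretation Module.module R M by (rule M)
interpretation I: ideal I R by (rule I)

lemma ideal_mult_submodule: "LinearCombinations.submodule R (ideal_mult R M I) M"
  unfolding ideal_mult_def by (rule span_is_submodule) (auto simp: I.a_subset[THEN subsetD])

interpretation A: abelian_subgroup "ideal_mult R M I" M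
  by (rule submodule_abelian_subgroup[OF M ideal_mult_submodule])

lemma ideal_mult_mem: "a \<in> I \<Longrightarrow> x \<in> carrier M \<Longrightarrow> a \<odot>\<^bsub>M\<^esub> x \<in> ideal_mult R M I"
  unfolding ideal_mult_def by (rule in_own_span[THEN subsetD]) (auto simp: I.a_subset[THEN subsetD])

lemma UN_smult_ideal_coset:
  assumes "r \<in> carrier R" "y \<in> carrier M"
  shows "(\<Union>a\<in>I +>\<^bsub>R\<^esub> r. \<Union>x\<in>ideal_mult R M I +>\<^bsub>M\<^esub> y. ideal_mult R M I +>\<^bsub>M\<^esub> (a \<odot>\<^bsub>M\<^esub> x)) =
    ideal_mult R M I +>\<^bsub>M\<^esub> (r \<odot>\<^bsub>M\<^esub> y)"
proof -
  have "(\<Union>x\<in>ideal_mult R M I +>\<^bsub>M\<^esub> y. ideal_mult R M I +>\<^bsub>M\<^esub> (a \<odot>\<^bsub>M\<^esub> x)) =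
    ideal_mult R M I +>\<^bsub>M\<^esub> (r \<odot>\<^bsub>M\<^esub> y)" if a: "a \<in> I +>\<^bsub>R\<^esub> r" for a
  proof -
    obtain i where i: "i \<in> I" "a = i \<oplus>\<^bsub>R\<^esub> r" using a unfolding a_r_coset_def' by auto
    have aR: "a \<in> carrier R" using i assms I.a_subset by auto
    have "a \<odot>\<^bsub>M\<^esub> y = i \<odot>\<^bsub>M\<^esub> y \<oplus>\<^bsub>M\<^esub> r \<odot>\<^bsub>M\<^esub> y" using i assms I.a_subset smult_l_distr by auto
    then have "a \<odot>\<^bsub>M\<^esub> y \<in> ideal_mult R M I +>\<^bsub>M\<^esub> (r \<odot>\<^bsub>M\<^esub> y)" using ideal_mult_mem i assms unfolding a_r_coset_def' by auto
    then have "ideal_mult R M I +>\<^bsub>M\<^esub> (a \<odot>\<^bsub>M\<^esub> y) =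
    ideal_mult R M I +>\<^bsub>M\<^esub> (r \<odot>\<^bsub>M\<^esub> y)"
      using submodule_coset_eq[OF M ideal_mult_submodule] assms by simp
    then show ?thesis using UN_smult_coset[OF M ideal_mult_submodule aR assms(2)] by simp
  qed
  note * = this
  have "r \<in> I +>\<^bsub>R\<^esub> r" using assms by (rule_tac I.a_rcos_self)
  then show ?thesis by (rule UN_constant_eq) (intro ballI *)
qed

lemma quot_by_ideal_smult:
  "r \<in> carrier R \<Longrightarrow> y \<in> carrier M \<Longrightarrow>
    (I +>\<^bsub>R\<^esub> r) \<odot>\<^bsub>quot_by_ideal R M I\<^esub> (ideal_mult R M I +>\<^bsub>M\<^esub> y) =
    ideal_mult R M I +>\<^bsub>M\<^esub> (r \<odot>\<^bsub>M\<^esub> y)"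
  by (simp add: quot_by_ideal_def UN_smult_ideal_coset)

lemma quot_by_ideal_add:
  "x \<in> carrier M \<Longrightarrow> y \<in> carrier M \<Longrightarrow>
    (ideal_mult R M I +>\<^bsub>M\<^esub> x) \<oplus>\<^bsub>quot_by_ideal R M I\<^esub> (ideal_mult R M I +>\<^bsub>M\<^esub> y) = ideal_mult R M I +>\<^bsub>M\<^esub> (x \<oplus>\<^bsub>M\<^esub> y)"
  by (simp add: quot_by_ideal_def A.a_rcos_sum)

lemma quot_by_ideal_carrier:
  "X \<in> carrier (quot_by_ideal R M I) \<longleftrightarrow> (\<exists>x\<in>carrier M. X = ideal_mult R M I +>\<^bsub>M\<^esub> x)"
  by (simp add: quot_by_ideal_def submodule_a_rcosets_iff[OF M ideal_mult_submodule])

lemma FactRing_carrier_iff: "A \<in> carrier (R Quot I) \<longleftrightarrow> (\<exists>a\<in>carrier R. A = I +>\<^bsub>R\<^esub> a)"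
  by (auto simp: FactRing_def A_RCOSETS_def')

lemma FactRing_coset_ops:
  "x \<in> carrier R \<Longrightarrow> y \<in> carrier R \<Longrightarrow> (I +>\<^bsub>R\<^esub> x) \<oplus>\<^bsub>R Quot I\<^esub> (I +>\<^bsub>R\<^esub> y) = I +>\<^bsub>R\<^esub> (x \<oplus>\<^bsub>R\<^esub> y)"
  "x \<in> carrier R \<Longrightarrow> y \<in> carrier R \<Longrightarrow> (I +>\<^bsub>R\<^esub> x) \<otimes>\<^bsub>R Quot I\<^esub> (I +>\<^bsub>R\<^esub> y) = I +>\<^bsub>R\<^esub> (x \<otimes>\<^bsub>R\<^esub> y)"
  "\<one>\<^bsub>R Quot I\<^esub> = I +>\<^bsub>R\<^esub> \<one>\<^bsub>R\<^esub>"
  by (simp_all add: FactRing_def I.a_rcos_sum I.rcoset_mult_add)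

lemma quot_by_ideal_is_module: "Module.module (R Quot I) (quot_by_ideal R M I)"
proof (rule moduleI)
  show "cring (R Quot I)" by (rule I.quotient_is_cring) (rule R.is_cring)
  show "abelian_group (quot_by_ideal R M I)"
    by (rule quot_abelian_group[OF M ideal_mult_submodule]) (auto simp: quot_by_ideal_def)
qed (auto simp: quot_by_ideal_carrier FactRing_carrier_iff
    quot_by_ideal_smult quot_by_ideal_add FactRing_coset_ops
    smult_l_distr smult_r_distr smult_assoc1)

end

lemma quot_by_ideal_vectorspace:
  assumes "Module.module R M" "maximalideal \<mm> R"
  shows "vectorspace (R Quot \<mm>) (quot_by_ideal R M \<mm>)"
  using assms quot_by_ideal_is_module[OF assms(1) maximalideal.axioms(1)]
    maximalideal.quotient_is_field[OF assms(2)]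
  by (auto simp: vectorspace_def Module.module_def)

context
  fixes R :: "('r, 'k) ring_scheme" and M :: "('r, 'm, 'l) module_scheme"
  assumes M: "Module.module R M"
begin

interpretation Module.module R M by (rule M)

lemma maximal_submoduleI:
  assumes N: "LinearCombinations.submodule R N M" and ne: "N \<noteq> carrier M"
    and max: "\<And>K. LinearCombinations.submodule R K M \<Longrightarrow> N \<subseteq> K \<Longrightarrow> K = N \<or> K = carrier M"
  shows "maximal_submodule R M N"
proof -
  interpret N: LinearCombinations.submodule R N M by (rule N)
  interpret A: abelian_subgroup N M by (rule submodule_abelian_subgroup[OF M N])
  have z: "\<zero>\<^bsub>quot_module M N\<^esub> = N" by (simp add: quot_module_def)
  have "carrier (quot_module M N) \<noteq> {N}"
  proof
    assume *: "carrier (quot_module M N) = {N}"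
    have "x \<in> N" if x: "x \<in> carrier M" for x
      using submodule_mem_coset[OF M N x] quot_module_carrier[OF M N, of "N +>\<^bsub>M\<^esub> x"] x * by auto
    then show False using ne N.subset by auto
  qed
  moreover have "P = {N} \<or> P = carrier (quot_module M N)"
    if P: "LinearCombinations.submodule R P (quot_module M N)" for P
  proof -
    interpret P: LinearCombinations.submodule R P "quot_module M N" by (rule P)
    let ?K = "{x \<in> carrier M. N +>\<^bsub>M\<^esub> x \<in> P}"
    have "LinearCombinations.submodule R ?K M"
    proof (rule LinearCombinations.submodule.intro[OF M])
      show "\<zero>\<^bsub>M\<^esub> \<in> ?K" using P.zero_closed A.a_rcos_const[OF N.zero_closed] unfolding z by simp
      show "v \<oplus>\<^bsub>M\<^esub> w \<in> ?K" if "v \<in> ?K" "w \<in> ?K" for v w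
        using that by (auto simp flip: quot_module_add[OF M N])
      show "c \<odot>\<^bsub>M\<^esub> v \<in> ?K" if "c \<in> carrier R" "v \<in> ?K" for c v
        using that by (auto simp flip: quot_module_smult[OF M N])
    qed auto
    moreover have "N \<subseteq> ?K" using P.zero_closed z N.subset A.a_rcos_const by auto
    ultimately consider "?K = N" | "?K = carrier M" using max by blast
    then show ?thesis
    proof cases
      case 1
      have "X = N" if X: "X \<in> P" for X
      proof -
        obtain x where x: "x \<in> carrier M" "X = N +>\<^bsub>M\<^esub> x"
          using X P.subset quot_module_carrier[OF M N] by blast
        then have "x \<in> N" using 1 X by blast
        then show ?thesis using x A.a_rcos_const by auto
      qed
      then have "P \<subseteq> {N}" by blast
      moreover have "N \<in> P" using P.zero_closed unfolding z .
      ultimately show ?thesis by (intro disjI1 subset_antisym) simp_all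
    next
      case 2
      have "X \<in> P" if X: "X \<in> carrier (quot_module M N)" for X
      proof -
        obtain x where x: "x \<in> carrier M" "X = N +>\<^bsub>M\<^esub> x"
          using X unfolding quot_module_carrier[OF M N] by (rule bexE)
        then have "x \<in> ?K" unfolding 2 by simp
        then show ?thesis using x by simp
      qed
      then show ?thesis using P.subset by auto
    qed
  qed
  ultimately show ?thesis
    unfolding maximal_submodule_def simple_module_def using N quot_module_is_module[OF M N] z by auto
qed

lemma jacobson_radical_submodule: "LinearCombinations.submodule R (jacobson_radical R M) M"
  unfolding jacobson_radical_def maximal_submodule_def
  by (rule LinearCombinations.submodule.intro[OF M]) (auto simp: submodule_def)

text \<open>The special case of finitely generated modules.\<close>

lemma finitely_generated_imp_small_jacobson_radical:
  assumes fg: "finitely_generated R M"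
  shows "small_submodule R M (jacobson_radical R M)"
  unfolding small_submodule_def
proof (intro conjI allI impI jacobson_radical_submodule)
  fix K assume K: "LinearCombinations.submodule R K M" and JK: "jacobson_radical R M <+>\<^bsub>M\<^esub> K = carrier M"
  obtain A where A: "finite A" "A \<subseteq> carrier M" "LinearCombinations.module.span R M A = carrier M"
    using fg unfolding finitely_generated_def by auto
  show "K = carrier M"
  proof (rule ccontr)
    assume ne: "K \<noteq> carrier M"
    let ?S = "{L. LinearCombinations.submodule R L M \<and> K \<subseteq> L \<and> L \<noteq> carrier M}"
    have "\<exists>L\<in>?S. \<forall>X\<in>?S. L \<subseteq> X \<longrightarrow> X = L"
    proof (rule subset_Zorn_nonempty)
      show "?S \<noteq> {}" using K ne by auto
      fix C assume C: "C \<noteq> {}" "subset.chain ?S C"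
      then have CS: "C \<subseteq> ?S" and lin: "\<And>X Y. X \<in> C \<Longrightarrow> Y \<in> C \<Longrightarrow> X \<subseteq> Y \<or> Y \<subseteq> X"
        unfolding subset_chain_def by auto
      have sub: "LinearCombinations.submodule R (\<Union>C) M"
      proof (rule LinearCombinations.submodule.intro[OF M])
        show "\<Union>C \<subseteq> carrier M" using CS by (auto simp: submodule_def)
        show "\<zero>\<^bsub>M\<^esub> \<in> \<Union>C" using CS C(1) by (auto simp: submodule_def)
        show "v \<oplus>\<^bsub>M\<^esub> w \<in> \<Union>C" if vw: "v \<in> \<Union>C" "w \<in> \<Union>C" for v w
        proof -
          obtain X Y where "X \<in> C" "Y \<in> C" "v \<in> X" "w \<in> Y" using vw by auto
          then obtain Z where "Z \<in> C" "v \<in> Z" "w \<in> Z" using lin by blast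
          then show ?thesis using CS unfolding submodule_def by blast
        qed
        show "c \<odot>\<^bsub>M\<^esub> v \<in> \<Union>C" if "c \<in> carrier R" "v \<in> \<Union>C" for c v
          using that CS unfolding submodule_def by blast
      qed
      have "\<Union>C \<noteq> carrier M"
      proof
        assume "\<Union>C = carrier M"
        then obtain L where L: "L \<in> C" "A \<subseteq> L"
          using finite_subset_Union_chain[OF A(1) _ C] A(2) by blast
        then have "LinearCombinations.module.span R M A \<subseteq> L"
          using CS span_is_subset by blast
        then show False using L CS A(3) by (auto simp: submodule_def)
      qed
      then show "\<Union>C \<in> ?S" using sub CS C(1) by auto
    qed
    then obtain L where LS: "L \<in> ?S" and mx0: "\<forall>X\<in>?S. L \<subseteq> X \<longrightarrow> X = L" by (rule bexE)
    have L: "LinearCombinations.submodule R L M" "K \<subseteq> L" "L \<noteq> carrier M" using LS by auto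
    have mx: "X = L \<or> X = carrier M" if "LinearCombinations.submodule R X M" "L \<subseteq> X" for X
      using bspec[OF mx0, of X] that L(2) by blast
    have "maximal_submodule R M L" by (rule maximal_submoduleI[OF L(1,3) mx])
    then have "jacobson_radical R M \<subseteq> L" unfolding jacobson_radical_def by auto
    then have "jacobson_radical R M <+>\<^bsub>M\<^esub> K \<subseteq> L"
      unfolding set_add_def' using LinearCombinations.submodule.m_closed[OF L(1)] L(2) by blast
    then have "carrier M \<subseteq> L" unfolding JK .
    then show False using LinearCombinations.submodule.subset[OF L(1)] L(3) by blast
  qed
qed

end

end

theory Submission
  imports Defs
begin

text \<open>
  Write \<open>J\<close> for the Jacobson radical and \<open>\<kappa>(\<mm>)\<close> for \<open>|R/\<mm>| + 1\<close>.

  Upper bound. For \<open>\<mm> \<in> S\<^sub>M\<close> the space \<open>M/\<mm>M\<close> maps onto a plane over \<open>R/\<mm>\<close>, and the preimages of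
  the \<open>\<kappa>(\<mm>)\<close> lines of this plane cover \<open>M\<close> (\<open>noncyclic_imp_small_cover\<close>).

  Lower bound. Finite dual Goldie dimension makes \<open>J\<close> the intersection of finitely many
  coindependent maximal submodules \<open>P\<close>; so \<open>M\<close> is generated by \<open>J\<close> and elements \<open>v\<^sub>P\<close>, where \<open>v\<^sub>P\<close>
  lies in all these submodules except \<open>P\<close> and is killed modulo \<open>J\<close> by a maximal ideal, the type
  of \<open>P\<close> (\<open>jacobson_radical_dual_family\<close>). As \<open>J\<close> is small, the members of a cover may be assumed
  to contain \<open>J\<close>. Suppose that there are fewer than \<open>\<kappa>(\<mm>)\<close> of them for all \<open>\<mm> \<in> S\<^sub>M\<close>. The elements
  \<open>v\<^sub>P\<close> are then combined one after the other into a single element \<open>x\<close> such that each member of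
  the cover containing \<open>x\<close> contains all \<open>v\<^sub>P\<close>, and therefore is \<open>M\<close>
  (\<open>exists_outside_few_submodules\<close>). When \<open>v = v\<^sub>P\<close> of type \<open>\<mm>\<close> is to be added to \<open>x\<close>, there are two
  cases. If \<open>\<mm> \<in> S\<^sub>M\<close>, the \<open>\<kappa>(\<mm>)\<close> points \<open>v\<close> and \<open>x + t v\<close> of the projective line through \<open>x\<close> and
  \<open>v\<close> are too many: a submodule containing two of them contains \<open>x\<close> and \<open>v\<close>, so the pigeonhole
  principle gives a suitable point (\<open>pencil_point\<close>). If \<open>\<mm> \<notin> S\<^sub>M\<close>, then \<open>\<mm>\<close> is the type of no other
  \<open>P\<close>, and the Chinese remainder theorem separates \<open>v\<close> from \<open>x\<close>, so \<open>x + v\<close> is suitable.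

  The same argument settles the case \<open>S\<^sub>M = {}\<close>: the condition on the number of submodules is then
  void, so even the family of all proper submodules does not cover \<open>M\<close>, and an element outside all
  of them generates \<open>M\<close>.
\<close>

section \<open>Adjoining an element to a submodule\<close>

context Module.module begin

abbreviation submod where "submod N \<equiv> LinearCombinations.submodule R N M"

lemma submod_add_mem_iff:
  assumes N: "submod N" and "x \<in> N" "y \<in> carrier M"
  shows "x \<oplus>\<^bsub>M\<^esub> y \<in> N \<longleftrightarrow> y \<in> N"
proof -
  interpret N: LinearCombinations.submodule R N M by (rule N)
  interpret A: abelian_subgroup N M by (rule submodule_abelian_subgroup[OF module_axioms N])
  have x: "x \<in> carrier M" using assms N.subset by auto
  have "y = \<ominus>\<^bsub>M\<^esub> x \<oplus>\<^bsub>M\<^esub> (x \<oplus>\<^bsub>M\<^esub> y)" using x assms by (simp add: M.r_neg1)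
  then show ?thesis using assms A.a_inv_closed N.m_closed by metis
qed

lemma submod_set_add:
  assumes N: "submod N" and K: "submod K"
  shows "submod (N <+>\<^bsub>M\<^esub> K)" 
proof -
  interpret N: LinearCombinations.submodule R N M by (rule N)
  interpret K: LinearCombinations.submodule R K M by (rule K)
  have c: "x \<in> N \<Longrightarrow> x \<in> carrier M" "y \<in> K \<Longrightarrow> y \<in> carrier M" for x y
    using N.subset K.subset by auto
  show ?thesis
  proof (rule LinearCombinations.submodule.intro[OF module_axioms])
    show "\<zero>\<^bsub>M\<^esub> \<in> N <+>\<^bsub>M\<^esub> K"
      unfolding set_add_def' by (auto intro!: bexI[of _ "\<zero>\<^bsub>M\<^esub>"])
    fix a b assume "a \<in> N <+>\<^bsub>M\<^esub> K" "b \<in> N <+>\<^bsub>M\<^esub> K"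
    then obtain x y x' y' where *: "x \<in> N" "y \<in> K" "x' \<in> N" "y' \<in> K" "a = x \<oplus>\<^bsub>M\<^esub> y" "b = x' \<oplus>\<^bsub>M\<^esub> y'"
      unfolding set_add_def' by auto
    then have "a \<oplus>\<^bsub>M\<^esub> b = (x \<oplus>\<^bsub>M\<^esub> x') \<oplus>\<^bsub>M\<^esub> (y \<oplus>\<^bsub>M\<^esub> y')"
      using c by (simp add: M.a_ac)
    then show "a \<oplus>\<^bsub>M\<^esub> b \<in> N <+>\<^bsub>M\<^esub> K"
      using * unfolding set_add_def' by blast
  next
    fix r a assume "r \<in> carrier R" "a \<in> N <+>\<^bsub>M\<^esub> K"
    then show "r \<odot>\<^bsub>M\<^esub> a \<in> N <+>\<^bsub>M\<^esub> K"
      unfolding set_add_def' by (auto simp: c smult_r_distr) (metis N.smult_closed K.smult_closed)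
  qed (auto simp: set_add_def' c)
qed

lemma submod_subset_set_add:
  assumes N: "submod N" and K: "submod K"
  shows "N \<subseteq> N <+>\<^bsub>M\<^esub> K" "K \<subseteq> N <+>\<^bsub>M\<^esub> K"
proof -
  have z: "\<zero>\<^bsub>M\<^esub> \<in> N" "\<zero>\<^bsub>M\<^esub> \<in> K" "N \<subseteq> carrier M" "K \<subseteq> carrier M" 
    using N K unfolding LinearCombinations.submodule_def by auto
  show "N \<subseteq> N <+>\<^bsub>M\<^esub> K"
  proof
    fix x assume x: "x \<in> N"
    then have "x \<oplus>\<^bsub>M\<^esub> \<zero>\<^bsub>M\<^esub> = x" using z(3) by auto
    then show "x \<in> N <+>\<^bsub>M\<^esub> K" unfolding set_add_def' using x z by force
  qed
  show "K \<subseteq> N <+>\<^bsub>M\<^esub> K" 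
  proof
    fix x assume x: "x \<in> K"
    then have "\<zero>\<^bsub>M\<^esub> \<oplus>\<^bsub>M\<^esub> x = x" using z(4) by auto
    then show "x \<in> N <+>\<^bsub>M\<^esub> K" unfolding set_add_def' using x z by force
  qed
qed

definition adjoin where
  "adjoin N x = N <+>\<^bsub>M\<^esub> {r \<odot>\<^bsub>M\<^esub> x |r. r \<in> carrier R}"

lemma submod_cyclic:
  assumes x: "x \<in> carrier M" 
  shows "submod {r \<odot>\<^bsub>M\<^esub> x |r. r \<in> carrier R}"
proof (rule LinearCombinations.submodule.intro[OF module_axioms])
  show "\<zero>\<^bsub>M\<^esub> \<in> {r \<odot>\<^bsub>M\<^esub> x |r. r \<in> carrier R}"
    using smult_l_null[OF x] by (metis (mono_tags, lifting) R.zero_closed mem_Collect_eq)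
  show "v \<oplus>\<^bsub>M\<^esub> w \<in> {r \<odot>\<^bsub>M\<^esub> x |r. r \<in> carrier R}"
    if "v \<in> {r \<odot>\<^bsub>M\<^esub> x |r. r \<in> carrier R}" "w \<in> {r \<odot>\<^bsub>M\<^esub> x |r. r \<in> carrier R}" for v w
    using that x by (auto simp flip: smult_l_distr)
  show "c \<odot>\<^bsub>M\<^esub> v \<in> {r \<odot>\<^bsub>M\<^esub> x |r. r \<in> carrier R}"
    if "c \<in> carrier R" "v \<in> {r \<odot>\<^bsub>M\<^esub> x |r. r \<in> carrier R}" for c v
    using that x by (auto simp flip: smult_assoc1)
qed (use x in auto)

lemma adjoin_iff: "z \<in> adjoin N x \<longleftrightarrow> (\<exists>n\<in>N. \<exists>r\<in>carrier R. z = n \<oplus>\<^bsub>M\<^esub> r \<odot>\<^bsub>M\<^esub> x)"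
  unfolding adjoin_def set_add_def' by auto

lemma submod_adjoin: "submod N \<Longrightarrow> x \<in> carrier M \<Longrightarrow> submod (adjoin N x)"
  unfolding adjoin_def by (intro submod_set_add submod_cyclic)

lemma subset_adjoin: "submod N \<Longrightarrow> x \<in> carrier M \<Longrightarrow> N \<subseteq> adjoin N x"
  unfolding adjoin_def by (intro submod_subset_set_add submod_cyclic)

lemma mem_adjoin: 
  assumes "submod N" "x \<in> carrier M" 
  shows "x \<in> adjoin N x"
proof -
  have "\<one> \<odot>\<^bsub>M\<^esub> x \<in> adjoin N x"
    using submod_subset_set_add(2)[OF assms(1) submod_cyclic[OF assms(2)]] unfolding adjoin_def
    using R.one_closed by blast
  then show ?thesis using assms(2) by simp
qed

section \<open>Maximal submodules and their annihilators\<close>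

text \<open>
  The converse of \<open>maximal_submoduleI\<close>: a submodule between \<open>P\<close> and \<open>M\<close> has an image in the simple
  module \<open>M/P\<close>, and it is recovered from that image because it contains \<open>P\<close>.
\<close>

lemma maximal_submoduleD:
  assumes P: "maximal_submodule R M P"
  shows "submod P" "P \<noteq> carrier M" "\<And>K. submod K \<Longrightarrow> P \<subseteq> K \<Longrightarrow> K = P \<or> K = carrier M"
proof -
  show sP: "submod P" using P unfolding maximal_submodule_def by simp
  interpret P: LinearCombinations.submodule R P M by (rule sP)
  interpret A: abelian_subgroup P M by (rule submodule_abelian_subgroup[OF module_axioms sP])
  let ?Q = "quot_module M P"
  have z: "\<zero>\<^bsub>?Q\<^esub> = P" by (simp add: quot_module_def)
  have simple: "carrier ?Q \<noteq> {P}" "\<And>N. LinearCombinations.submodule R N ?Q \<Longrightarrow> N = {P} \<or> N = carrier ?Q"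
    using P unfolding maximal_submodule_def simple_module_def z by auto
  show "P \<noteq> carrier M"
  proof
    assume *: "P = carrier M"
    have "X = P" if "X \<in> carrier ?Q" for X
      using that A.a_rcos_const quot_module_carrier[OF module_axioms sP] * by metis
    moreover have "P \<in> carrier ?Q"
      using quot_module_carrier[OF module_axioms sP] A.a_rcos_const[OF P.zero_closed] by (metis M.zero_closed)
    ultimately show False using simple(1) by blast
  qed
  fix K assume K: "submod K" "P \<subseteq> K"
  interpret K: LinearCombinations.submodule R K M by (rule K)
  have Kc: "x \<in> K \<Longrightarrow> x \<in> carrier M" for x using K.subset by auto
  let ?K = "(\<lambda>x. P +>\<^bsub>M\<^esub> x) ` K"
  have "LinearCombinations.submodule R ?K ?Q"
  proof (rule LinearCombinations.submodule.intro[OF quot_module_is_module[OF module_axioms sP]])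
    show "?K \<subseteq> carrier ?Q" using Kc quot_module_carrier[OF module_axioms sP] by blast
    show "\<zero>\<^bsub>?Q\<^esub> \<in> ?K" unfolding z using A.a_rcos_const[OF P.zero_closed] K.zero_closed by (metis imageI)
  qed (auto simp: quot_module_add[OF module_axioms sP] quot_module_smult[OF module_axioms sP] Kc)
  then consider "?K = {P}" | "?K = carrier ?Q" using simple(2) by blast
  then show "K = P \<or> K = carrier M"
  proof cases
    case 1
    then have "x \<in> P" if "x \<in> K" for x
      using that submodule_mem_coset[OF module_axioms sP Kc[OF that]] by auto
    then show ?thesis using K by auto
  next
    case 2
    have "x \<in> K" if x: "x \<in> carrier M" for x
    proof -
      have "P +>\<^bsub>M\<^esub> x \<in> ?K" using x 2 quot_module_carrier[OF module_axioms sP] by auto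
      then obtain k where k: "k \<in> K" "P +>\<^bsub>M\<^esub> x = P +>\<^bsub>M\<^esub> k" by auto
      then have "x \<in> P +>\<^bsub>M\<^esub> k" using submodule_mem_coset[OF module_axioms sP x] by auto
      then show ?thesis using k K unfolding a_r_coset_def' by auto
    qed
    then show ?thesis using K.subset by auto
  qed
qed

lemma maximal_submodule_decomp:
  assumes P: "maximal_submodule R M P" and v: "v \<in> carrier M" "v \<notin> P" and z: "z \<in> carrier M"
  obtains p r where "p \<in> P" "r \<in> carrier R" "z = p \<oplus>\<^bsub>M\<^esub> r \<odot>\<^bsub>M\<^esub> v"
proof -
  note sP = maximal_submoduleD(1)[OF P]
  have "adjoin P v \<noteq> P" using mem_adjoin[OF sP v(1)] v(2) by metis
  then have "adjoin P v = carrier M"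
    using maximal_submoduleD(3)[OF P submod_adjoin[OF sP v(1)] subset_adjoin[OF sP v(1)]] by simp
  then show ?thesis using z that adjoin_iff by blast
qed

text \<open>
  The annihilator of \<open>M/P\<close>. For maximal \<open>P\<close> this is the maximal ideal \<open>\<mm>\<close> with \<open>M/P \<cong> R/\<mm>\<close>,
  which serves as the type of \<open>P\<close>.
\<close>

definition quot_ann where
  "quot_ann P = {r \<in> carrier R. \<forall>z\<in>carrier M. r \<odot>\<^bsub>M\<^esub> z \<in> P}"

text \<open>
  \<open>M/P\<close> is generated by the class of any \<open>v \<notin> P\<close>, and \<open>R\<close> is commutative, so \<open>r\<close> kills \<open>M/P\<close>
  as soon as it kills that class.
\<close>

lemma quot_ann_iff:
  assumes P: "maximal_submodule R M P" and v: "v \<in> carrier M" "v \<notin> P" and r: "r \<in> carrier R"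
  shows "r \<in> quot_ann P \<longleftrightarrow> r \<odot>\<^bsub>M\<^esub> v \<in> P"
proof
  assume *: "r \<odot>\<^bsub>M\<^esub> v \<in> P"
  interpret P: LinearCombinations.submodule R P M by (rule maximal_submoduleD(1)[OF P])
  have "r \<odot>\<^bsub>M\<^esub> z \<in> P" if z: "z \<in> carrier M" for z
  proof -
    obtain p s where ps: "p \<in> P" "s \<in> carrier R" "z = p \<oplus>\<^bsub>M\<^esub> s \<odot>\<^bsub>M\<^esub> v"
      using maximal_submodule_decomp[OF P v z] .
    have pM: "p \<in> carrier M" using ps(1) P.subset by auto
    have "r \<odot>\<^bsub>M\<^esub> z = r \<odot>\<^bsub>M\<^esub> p \<oplus>\<^bsub>M\<^esub> (r \<otimes> s) \<odot>\<^bsub>M\<^esub> v"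
      unfolding ps(3) using ps(2) pM r v(1) by (simp add: smult_r_distr smult_assoc1)
    also have "\<dots> = r \<odot>\<^bsub>M\<^esub> p \<oplus>\<^bsub>M\<^esub> s \<odot>\<^bsub>M\<^esub> (r \<odot>\<^bsub>M\<^esub> v)"
      using ps(2) r v(1) by (simp flip: smult_assoc1 add: R.m_comm)
    also have "\<dots> \<in> P" using * ps(1,2) r by simp
    finally show ?thesis .
  qed
  then show "r \<in> quot_ann P" using r unfolding quot_ann_def by auto
qed (use v in \<open>auto simp: quot_ann_def\<close>)

lemma quot_ann_maximalideal:
  assumes P: "maximal_submodule R M P"
  shows "maximalideal (quot_ann P) R"
proof -
  interpret P: LinearCombinations.submodule R P M by (rule maximal_submoduleD(1)[OF P])
  obtain v where v: "v \<in> carrier M" "v \<notin> P" using maximal_submoduleD(2)[OF P] P.subset by auto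
  show ?thesis
  proof (rule maximalidealI)
    show "ideal (quot_ann P) R"
    proof (rule idealI)
      show "subgroup (quot_ann P) (add_monoid R)"
      proof (rule R.add.subgroupI)
        show "quot_ann P \<noteq> {}" by (rule ex_in_conv[THEN iffD1], rule exI[of _ \<zero>]) (auto simp: quot_ann_def)
        show "\<ominus> a \<in> quot_ann P" if a: "a \<in> quot_ann P" for a
        proof -
          have "(\<ominus> a) \<odot>\<^bsub>M\<^esub> z = a \<odot>\<^bsub>M\<^esub> (\<ominus>\<^bsub>M\<^esub> z)" if "z \<in> carrier M" for z
            using a that by (simp add: quot_ann_def smult_l_minus smult_r_minus)
          then show ?thesis using a by (auto simp: quot_ann_def)
        qed
      qed (auto simp: quot_ann_def smult_l_distr)
    qed (auto simp: quot_ann_def smult_assoc1 R.ring_axioms)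
    show "carrier R \<noteq> quot_ann P"
      using v R.one_closed unfolding quot_ann_def by (metis (no_types, lifting) mem_Collect_eq smult_one)
    fix K assume K: "ideal K R" "quot_ann P \<subseteq> K" "K \<subseteq> carrier R"
    interpret K: ideal K R by (rule K)
    show "K = quot_ann P \<or> K = carrier R"
    proof (rule disjCI)
      assume "K \<noteq> carrier R"
      have "r \<in> quot_ann P" if r: "r \<in> K" for r
      proof (rule ccontr)
        assume rn: "r \<notin> quot_ann P"
        have rR: "r \<in> carrier R" using r K by auto
        have "r \<odot>\<^bsub>M\<^esub> v \<notin> P" "r \<odot>\<^bsub>M\<^esub> v \<in> carrier M" using quot_ann_iff[OF P v rR] rn rR v by auto
        then obtain p s where ps: "p \<in> P" "s \<in> carrier R" "v = p \<oplus>\<^bsub>M\<^esub> s \<odot>\<^bsub>M\<^esub> (r \<odot>\<^bsub>M\<^esub> v)"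
          using maximal_submodule_decomp[OF P _ _ v(1)] by blast
        have pM: "p \<in> carrier M" using ps P.subset by auto
        have "(\<one> \<ominus> s \<otimes> r) \<odot>\<^bsub>M\<^esub> v = v \<ominus>\<^bsub>M\<^esub> s \<odot>\<^bsub>M\<^esub> (r \<odot>\<^bsub>M\<^esub> v)"
          using ps rR v by (simp add: a_minus_def smult_l_distr smult_l_minus smult_assoc1)
        also have "\<dots> = p"
          using pM ps(2) rR v by (subst ps(3)) (simp add: a_minus_def M.a_assoc M.r_neg)
        finally have "\<one> \<ominus> s \<otimes> r \<in> quot_ann P" using quot_ann_iff[OF P v] ps rR by auto
        then have "(\<one> \<ominus> s \<otimes> r) \<oplus> s \<otimes> r \<in> K" using K(2) r ps(2) K.I_l_closed K.a_closed by auto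
        moreover have "(\<one> \<ominus> s \<otimes> r) \<oplus> s \<otimes> r = \<one>" using ps(2) rR by algebra
        ultimately show False using K.one_imp_carrier \<open>K \<noteq> carrier R\<close> by auto
      qed
      then show "K = quot_ann P" using K(2) by auto
    qed
  qed
qed

lemma maximalideal_inverse:
  assumes m: "maximalideal \<mm> R" and b: "b \<in> carrier R" "b \<notin> \<mm>"
  obtains s i where "s \<in> carrier R" "i \<in> \<mm>" "i \<oplus> s \<otimes> b = \<one>"
proof -
  interpret m: maximalideal \<mm> R by (rule m)
  have I: "ideal (\<mm> <+>\<^bsub>R\<^esub> PIdl b) R" by (intro add_ideals m.ideal_axioms cgenideal_ideal b)
  interpret I: ideal "\<mm> <+>\<^bsub>R\<^esub> PIdl b" R by (rule I)
  have z: "\<zero> \<in> \<mm>" "\<zero> \<in> PIdl b" using m.zero_closed cgenideal_ideal[OF b(1)]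
    by (auto simp: additive_subgroup.zero_closed ideal_def)
  have sub: "\<mm> \<subseteq> \<mm> <+>\<^bsub>R\<^esub> PIdl b"
  proof
    fix x assume x: "x \<in> \<mm>"
    then have "x \<oplus> \<zero> \<in> \<mm> <+>\<^bsub>R\<^esub> PIdl b" using z(2) unfolding set_add_def' by blast
    then show "x \<in> \<mm> <+>\<^bsub>R\<^esub> PIdl b" using x m.a_subset by auto
  qed
  have "\<zero> \<oplus> b \<in> \<mm> <+>\<^bsub>R\<^esub> PIdl b"
    unfolding set_add_def' using cgenideal_self[OF b(1)] z(1) by blast
  then have "b \<in> \<mm> <+>\<^bsub>R\<^esub> PIdl b" using b by simp
  then have "\<mm> <+>\<^bsub>R\<^esub> PIdl b = carrier R"
    using m.I_maximal[OF I sub I.a_subset] b by auto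
  then have "\<one> \<in> \<mm> <+>\<^bsub>R\<^esub> PIdl b" by simp
  then obtain i a where ia: "i \<in> \<mm>" "a \<in> PIdl b" "\<one> = i \<oplus> a"
    unfolding set_add_def' by auto
  then obtain s where "s \<in> carrier R" "a = s \<otimes> b" unfolding cgenideal_def by auto
  then show ?thesis using that ia by simp
qed

text \<open>
  Modulo \<open>N\<close> the element \<open>v\<close> is killed by \<open>\<mm>\<close>, so it behaves like a vector over the field \<open>R/\<mm>\<close>,
  and a scalar outside \<open>\<mm>\<close> can be divided out.
\<close>

lemma residue_cancel:
  assumes m: "maximalideal \<mm> R" and N: "submod N" and v: "v \<in> carrier M" "\<And>i. i \<in> \<mm> \<Longrightarrow> i \<odot>\<^bsub>M\<^esub> v \<in> N"
    and b: "b \<in> carrier R" "b \<notin> \<mm>" "b \<odot>\<^bsub>M\<^esub> v \<in> N"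
  shows "v \<in> N"
proof -
  interpret N: LinearCombinations.submodule R N M by (rule N)
  interpret m: maximalideal \<mm> R by (rule m)
  obtain s i where si: "s \<in> carrier R" "i \<in> \<mm>" "i \<oplus> s \<otimes> b = \<one>"
    using maximalideal_inverse[OF m b(1,2)] .
  have "v = (i \<oplus> s \<otimes> b) \<odot>\<^bsub>M\<^esub> v" using si v by simp
  also have "\<dots> = i \<odot>\<^bsub>M\<^esub> v \<oplus>\<^bsub>M\<^esub> s \<odot>\<^bsub>M\<^esub> (b \<odot>\<^bsub>M\<^esub> v)"
    using si(1,2) v b m.a_subset by (subst smult_l_distr) (auto simp: smult_assoc1)
  also have "\<dots> \<in> N" using si v b by auto
  finally show ?thesis .
qed

section \<open>Finite dual Goldie dimension\<close>

text \<open>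
  Coindependence of a finite set of maximal submodules, in the form in which it is used: for each
  \<open>P\<close> there is an element whose only nonzero coordinate in the \<open>M/Q\<close> is the one at \<open>P\<close>.
  Since each \<open>M/P\<close> is simple, this is equivalent to surjectivity of \<open>M \<rightarrow> \<Prod> M/P\<close>.
\<close>

definition dual_family :: "'c set set \<Rightarrow> ('c set \<Rightarrow> 'c) \<Rightarrow> bool" where
  "dual_family \<P> v \<longleftrightarrow> finite \<P> \<and> (\<forall>P\<in>\<P>. maximal_submodule R M P) \<and>
     (\<forall>P\<in>\<P>. v P \<in> carrier M \<and> v P \<notin> P \<and> (\<forall>Q\<in>\<P>. Q \<noteq> P \<longrightarrow> v P \<in> Q))"

text \<open>
  Coordinates can be corrected one at a time: a multiple of \<open>v Q\<close> changes the coordinate at \<open>Q\<close>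
  arbitrarily and leaves the others alone.
\<close>

lemma dual_family_simultaneous:
  assumes dual: "dual_family \<P> v" and z: "\<And>P. P \<in> \<P> \<Longrightarrow> z P \<in> carrier M"
  shows "\<exists>x\<in>carrier M. \<forall>P\<in>\<P>. P +>\<^bsub>M\<^esub> x = P +>\<^bsub>M\<^esub> z P"
proof -
  have fin: "finite \<P>" and max: "P \<in> \<P> \<Longrightarrow> maximal_submodule R M P"
    and v: "P \<in> \<P> \<Longrightarrow> v P \<in> carrier M" "P \<in> \<P> \<Longrightarrow> v P \<notin> P"
      "P \<in> \<P> \<Longrightarrow> Q \<in> \<P> \<Longrightarrow> Q \<noteq> P \<Longrightarrow> v P \<in> Q" for P Q
    using dual unfolding dual_family_def by auto
  have "\<exists>x\<in>carrier M. \<forall>P\<in>\<Q>. P +>\<^bsub>M\<^esub> x = P +>\<^bsub>M\<^esub> z P" if "\<Q> \<subseteq> \<P>" for \<Q>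
    using finite_subset[OF that fin] that
  proof (induction \<Q> rule: finite_induct)
    case empty
    then show ?case using M.zero_closed by blast
  next
    case (insert Q \<Q>)
    then obtain x where x: "x \<in> carrier M" "\<And>P. P \<in> \<Q> \<Longrightarrow> P +>\<^bsub>M\<^esub> x = P +>\<^bsub>M\<^esub> z P" by auto
    have Q: "Q \<in> \<P>" using insert by auto
    note sQ = maximal_submoduleD(1)[OF max[OF Q]]
    have zx: "z Q \<ominus>\<^bsub>M\<^esub> x \<in> carrier M" using z[OF Q] x by auto
    obtain q r where qr: "q \<in> Q" "r \<in> carrier R" "z Q \<ominus>\<^bsub>M\<^esub> x = q \<oplus>\<^bsub>M\<^esub> r \<odot>\<^bsub>M\<^esub> v Q"
      using maximal_submodule_decomp[OF max[OF Q] v(1,2)[OF Q] zx] .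
    have qM: "q \<in> carrier M" using qr(1) LinearCombinations.submodule.subset[OF sQ] by auto
    have rv: "r \<odot>\<^bsub>M\<^esub> v Q \<in> carrier M" using qr(2) v(1)[OF Q] by simp
    have zQ: "z Q = q \<oplus>\<^bsub>M\<^esub> (r \<odot>\<^bsub>M\<^esub> v Q \<oplus>\<^bsub>M\<^esub> x)"
    proof -
      have "z Q = (z Q \<ominus>\<^bsub>M\<^esub> x) \<oplus>\<^bsub>M\<^esub> x"
        using z[OF Q] x(1) by (simp add: a_minus_def M.a_assoc M.l_neg)
      also have "\<dots> = q \<oplus>\<^bsub>M\<^esub> (r \<odot>\<^bsub>M\<^esub> v Q \<oplus>\<^bsub>M\<^esub> x)"
        unfolding qr(3) using qM rv x(1) by (simp add: M.a_assoc)
      finally show ?thesis .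
    qed
    let ?y = "r \<odot>\<^bsub>M\<^esub> v Q \<oplus>\<^bsub>M\<^esub> x"
    have y: "?y \<in> carrier M" using rv x(1) by simp
    have "z Q \<in> Q +>\<^bsub>M\<^esub> ?y" unfolding zQ a_r_coset_def' using qr(1) by auto
    then have "Q +>\<^bsub>M\<^esub> ?y = Q +>\<^bsub>M\<^esub> z Q"
      using submodule_coset_eq[OF module_axioms sQ y] by simp
    moreover have "P +>\<^bsub>M\<^esub> ?y = P +>\<^bsub>M\<^esub> z P" if P: "P \<in> \<Q>" for P
    proof -
      have PP: "P \<in> \<P>" "P \<noteq> Q" using P insert by auto
      note sP = maximal_submoduleD(1)[OF max[OF PP(1)]]
      have "r \<odot>\<^bsub>M\<^esub> v Q \<in> P"
        using v(3)[OF Q PP] qr(2) LinearCombinations.submodule.smult_closed[OF sP] by simp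
      then have "?y \<in> P +>\<^bsub>M\<^esub> x" unfolding a_r_coset_def' by auto
      then have "P +>\<^bsub>M\<^esub> ?y = P +>\<^bsub>M\<^esub> x"
        using submodule_coset_eq[OF module_axioms sP x(1)] by simp
      then show ?thesis using x(2)[OF P] by simp
    qed
    ultimately show ?case using y by (intro bexI[of _ ?y]) auto
  qed
  then show ?thesis by blast
qed

lemma dual_family_maps_onto_product:
  assumes dual: "dual_family \<P> v"
  shows "maps_onto_product R M (card \<P>)"
proof -
  have fin: "finite \<P>" and max: "P \<in> \<P> \<Longrightarrow> maximal_submodule R M P" for P
    using dual unfolding dual_family_def by auto
  have sub: "P \<in> \<P> \<Longrightarrow> submod P" for P using maximal_submoduleD(1)[OF max] by auto
  let ?n = "card \<P>"
  obtain P where "bij_betw P {0..<?n} \<P>" using ex_bij_betw_nat_finite[OF fin] by auto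
  then have P: "bij_betw P {..<?n} \<P>" by (simp add: lessThan_atLeast0)
  then have PP: "i < ?n \<Longrightarrow> P i \<in> \<P>" for i by (auto simp: bij_betw_def)
  let ?N = "\<lambda>i. quot_module M (P i)"
  let ?f = "\<lambda>x. \<lambda>i\<in>{..<?n}. P i +>\<^bsub>M\<^esub> x"
  let ?Pr = "product_module {..<?n} ?N"
  show ?thesis unfolding maps_onto_product_def
  proof (intro exI conjI allI impI)
    fix i assume i: "i < ?n"
    show "Module.module R (?N i)" by (rule quot_module_is_module[OF module_axioms sub[OF PP[OF i]]])
    show "carrier (?N i) \<noteq> {\<zero>\<^bsub>?N i\<^esub>}"
      using max[OF PP[OF i]] unfolding maximal_submodule_def simple_module_def by simp
  next
    have qc: "P i +>\<^bsub>M\<^esub> x \<in> carrier (?N i)" if "i < ?n" "x \<in> carrier M" for i x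
      using that quot_module_carrier[OF module_axioms sub[OF PP]] by blast
    show "?f \<in> LinearCombinations.module_hom R M ?Pr"
      unfolding LinearCombinations.module_hom_def product_module_def
      by (auto simp: qc quot_module_add[OF module_axioms sub[OF PP]]
          quot_module_smult[OF module_axioms sub[OF PP]] intro!: restrict_ext)
    show "?f ` carrier M = carrier ?Pr"
    proof
      show "?f ` carrier M \<subseteq> carrier ?Pr" unfolding product_module_def by (auto simp: qc)
      show "carrier ?Pr \<subseteq> ?f ` carrier M"
      proof
        fix g assume "g \<in> carrier ?Pr"
        then have g: "g \<in> (\<Pi>\<^sub>E i\<in>{..<?n}. carrier (?N i))" unfolding product_module_def by simp
        have "\<exists>x. x \<in> carrier M \<and> g i = P i +>\<^bsub>M\<^esub> x" if i: "i < ?n" for i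
        proof -
          have "g i \<in> carrier (?N i)" using PiE_mem[OF g, of i] i by simp
          then show ?thesis unfolding quot_module_carrier[OF module_axioms sub[OF PP[OF i]]] by blast
        qed
        then obtain z where z: "\<And>i. i < ?n \<Longrightarrow> z i \<in> carrier M \<and> g i = P i +>\<^bsub>M\<^esub> z i"
          by metis
        let ?z = "\<lambda>Q. z (the_inv_into {..<?n} P Q)"
        have inv: "the_inv_into {..<?n} P (P i) = i" if "i < ?n" for i
          using the_inv_into_f_f[of P "{..<?n}" i] P that by (auto simp: bij_betw_def)
        have "?z Q \<in> carrier M" if "Q \<in> \<P>" for Q
        proof -
          have "Q \<in> P ` {..<?n}" using that bij_betw_imp_surj_on[OF P] by simp
          then obtain i where "i < ?n" "Q = P i" by auto
          then show ?thesis using inv z by auto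
        qed
        from dual_family_simultaneous[OF dual this]
        obtain x where x: "x \<in> carrier M" "\<forall>Q\<in>\<P>. Q +>\<^bsub>M\<^esub> x = Q +>\<^bsub>M\<^esub> ?z Q" by (rule bexE)
        have "g = ?f x"
        proof
          fix i show "g i = ?f x i"
          proof (cases "i < ?n")
            case True
            then show ?thesis using bspec[OF x(2) PP[OF True]] inv[OF True] z[OF True] by simp
          next
            case False
            then show ?thesis using g by (auto simp: PiE_def extensional_def)
          qed
        qed
        then show "g \<in> ?f ` carrier M" using x by blast
      qed
    qed
  qed
qed

text \<open>
  Subtracting suitable multiples of the \<open>v P\<close> from an element of \<open>M\<close> removes its coordinates one by
  one and leaves an element of the intersection.
\<close>

lemma dual_family_generates:
  assumes dual: "dual_family \<P> v" and N: "submod N"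
    and JN: "carrier M \<inter> \<Inter>\<P> \<subseteq> N" and vN: "\<And>P. P \<in> \<P> \<Longrightarrow> v P \<in> N"
  shows "N = carrier M"
proof -
  have fin: "finite \<P>" and max: "P \<in> \<P> \<Longrightarrow> maximal_submodule R M P"
    and v: "P \<in> \<P> \<Longrightarrow> v P \<in> carrier M" "P \<in> \<P> \<Longrightarrow> v P \<notin> P"
      "P \<in> \<P> \<Longrightarrow> Q \<in> \<P> \<Longrightarrow> Q \<noteq> P \<Longrightarrow> v P \<in> Q" for P Q
    using dual unfolding dual_family_def by auto
  note sub = maximal_submoduleD(1)[OF max]
  interpret N: LinearCombinations.submodule R N M by (rule N)
  (* The statement for \<Q> = \<P> has no condition on z beyond membership in M; enlarging \<Q>
     by Q costs one multiple of v Q. *)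
  have "z \<in> N" if "z \<in> carrier M" "\<forall>P\<in>\<P> - \<Q>. z \<in> P" "\<Q> \<subseteq> \<P>" for z \<Q>
    using finite_subset[OF that(3) fin] that
  proof (induction \<Q> arbitrary: z rule: finite_induct)
    case empty
    then show ?case using JN by auto
  next
    case (insert Q \<Q>)
    have Q: "Q \<in> \<P>" using insert by auto
    obtain q r where qr: "q \<in> Q" "r \<in> carrier R" "z = q \<oplus>\<^bsub>M\<^esub> r \<odot>\<^bsub>M\<^esub> v Q"
      using maximal_submodule_decomp[OF max[OF Q] v(1,2)[OF Q] insert.prems(1)] .
    have qM: "q \<in> carrier M" using qr(1) LinearCombinations.submodule.subset[OF sub[OF Q]] by blast
    have "q \<in> P" if P: "P \<in> \<P> - \<Q>" for P
    proof (cases "P = Q")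
      case False
      then have "z \<in> P" "v Q \<in> P" using P insert.prems(2) v(3)[OF Q] by auto
      then have "r \<odot>\<^bsub>M\<^esub> v Q \<oplus>\<^bsub>M\<^esub> q \<in> P" unfolding qr(3) using qM v(1)[OF Q] qr(2) by (simp add: M.a_comm)
      moreover have "r \<odot>\<^bsub>M\<^esub> v Q \<in> P"
        using LinearCombinations.submodule.smult_closed[OF sub qr(2) \<open>v Q \<in> P\<close>] P by blast
      ultimately show ?thesis using submod_add_mem_iff[OF sub _ qM] P by blast
    qed (use qr(1) in simp)
    then have "q \<in> N" using insert.IH[OF qM] insert.prems(3) by simp
    then show ?case unfolding qr(3) using vN[OF Q] qr(2) by simp
  qed
  from this[of _ \<P>] have "carrier M \<subseteq> N" by blast
  then show ?thesis using N.subset by blast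
qed

text \<open>
  The new element \<open>w\<close> is dual to \<open>Q\<close>. Each old \<open>v P\<close> is moved into \<open>Q\<close> by a multiple of \<open>w\<close>, which
  has no effect on the old coordinates.
\<close>

lemma dual_family_insert:
  assumes dual: "dual_family \<P> v" and Q: "maximal_submodule R M Q"
    and w: "w \<in> carrier M" "\<And>P. P \<in> \<P> \<Longrightarrow> w \<in> P" "w \<notin> Q"
  shows "\<exists>v'. dual_family (insert Q \<P>) v'"
proof -
  have fin: "finite \<P>" and max: "P \<in> \<P> \<Longrightarrow> maximal_submodule R M P"
    and v: "P \<in> \<P> \<Longrightarrow> v P \<in> carrier M" "P \<in> \<P> \<Longrightarrow> v P \<notin> P"
      "P \<in> \<P> \<Longrightarrow> P' \<in> \<P> \<Longrightarrow> P' \<noteq> P \<Longrightarrow> v P \<in> P'" for P P'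
    using dual unfolding dual_family_def by auto
  have "\<exists>u\<in>carrier M. u \<in> Q \<and> u \<notin> P \<and> (\<forall>P'\<in>\<P>. P' \<noteq> P \<longrightarrow> u \<in> P')" if P: "P \<in> \<P>" for P
  proof -
    obtain q r where qr: "q \<in> Q" "r \<in> carrier R" "v P = q \<oplus>\<^bsub>M\<^esub> r \<odot>\<^bsub>M\<^esub> w"
      using maximal_submodule_decomp[OF Q w(1,3) v(1)[OF P]] .
    have qM: "q \<in> carrier M"
      using qr(1) LinearCombinations.submodule.subset[OF maximal_submoduleD(1)[OF Q]] by auto
    have vP: "v P = r \<odot>\<^bsub>M\<^esub> w \<oplus>\<^bsub>M\<^esub> q" unfolding qr(3) using qM qr(2) w(1) by (simp add: M.a_comm)
    have iff: "v P \<in> P' \<longleftrightarrow> q \<in> P'" if P': "P' \<in> \<P>" for P'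
    proof -
      note sP' = maximal_submoduleD(1)[OF max[OF P']]
      show ?thesis unfolding vP
        by (rule submod_add_mem_iff[OF sP' LinearCombinations.submodule.smult_closed[OF sP' qr(2) w(2)[OF P']] qM])
    qed
    then show ?thesis using qM qr(1) v(2,3)[OF P] P by blast
  qed
  then obtain u where u: "\<And>P. P \<in> \<P> \<Longrightarrow> u P \<in> carrier M \<and> u P \<in> Q \<and> u P \<notin> P \<and> (\<forall>P'\<in>\<P>. P' \<noteq> P \<longrightarrow> u P \<in> P')"
    by metis
  have "Q \<notin> \<P>" using w by auto
  then have "dual_family (insert Q \<P>) (u(Q := w))"
    unfolding dual_family_def using fin max Q u w by auto
  then show ?thesis by blast
qed

text \<open>
  A dual family of \<open>n\<close> submodules maps \<open>M\<close> onto a product of \<open>n\<close> nonzero modules, so finite dual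
  Goldie dimension bounds \<open>n\<close>. A family of maximal size cannot be enlarged, hence every maximal
  submodule contains its intersection. Thus \<open>M/J(M)\<close> is a finite product of simple modules.
\<close>

lemma jacobson_radical_dual_family:
  assumes "dual_goldie_dim R M < \<infinity>"
  obtains \<P> v where "dual_family \<P> v" "jacobson_radical R M = carrier M \<inter> \<Inter>\<P>"
proof -
  let ?S = "{n. maps_onto_product R M n}"
  obtain b where b: "dual_goldie_dim R M = enat b" using assms by auto
  have bd: "n \<le> b" if "maps_onto_product R M n" for n
  proof -
    have "enat n \<le> dual_goldie_dim R M" unfolding dual_goldie_dim_def by (rule Sup_upper) (use that in auto)
    then show ?thesis using b by simp
  qed
  let ?D = "\<lambda>n. \<exists>\<P> v. dual_family \<P> v \<and> card \<P> = n"
  have D0: "?D 0" by (rule exI[of _ "{}"]) (simp add: dual_family_def)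
  have Db: "?D n \<Longrightarrow> n \<le> b" for n using bd dual_family_maps_onto_product by blast
  define n where "n = Greatest ?D"
  have n: "?D n" "\<And>k. ?D k \<Longrightarrow> k \<le> n"
    unfolding n_def using GreatestI_nat[of ?D 0 b] Greatest_le_nat[of ?D _ b] D0 Db by blast+
  obtain \<P> v where \<P>: "dual_family \<P> v" "card \<P> = n" using n(1) by blast
  have fin: "finite \<P>" and max: "\<And>P. P \<in> \<P> \<Longrightarrow> maximal_submodule R M P"
    using \<P>(1) unfolding dual_family_def by auto
  have "w \<in> Q" if Q: "maximal_submodule R M Q" and w: "w \<in> carrier M" "\<And>P. P \<in> \<P> \<Longrightarrow> w \<in> P" for Q w
  proof (rule ccontr)
    assume wQ: "w \<notin> Q"
    then have "card (insert Q \<P>) = Suc n" using w(2) fin \<P>(2) by (subst card_insert_disjoint) auto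
    then have "?D (Suc n)" using dual_family_insert[OF \<P>(1) Q w wQ] by blast
    then show False using n(2) by fastforce
  qed
  then have "jacobson_radical R M = carrier M \<inter> \<Inter>\<P>"
    unfolding jacobson_radical_def using max by blast
  then show ?thesis using that \<P>(1) by blast
qed

section \<open>Covers by a pencil of submodules\<close>

text \<open>
  A vector space has dimension at most one iff it is spanned by a single vector, so the dimension
  condition on \<open>M/\<mm>M\<close> says that no \<open>y\<close> generates \<open>M\<close> modulo \<open>\<mm>M\<close>.
\<close>

lemma noncyclic_maximal_ideals_iff:
  "\<mm> \<in> noncyclic_maximal_ideals R M \<longleftrightarrow>
    maximalideal \<mm> R \<and> (\<forall>y\<in>carrier M. adjoin (ideal_mult R M \<mm>) y \<noteq> carrier M)"
proof (cases "maximalideal \<mm> R")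
  case True
  then interpret m: maximalideal \<mm> R .
  let ?V = "quot_by_ideal R M \<mm>" and ?I = "ideal_mult R M \<mm>"
  interpret V: vectorspace "R Quot \<mm>" ?V by (rule quot_by_ideal_vectorspace[OF module_axioms True])
  note sI = ideal_mult_submodule[OF module_axioms m.ideal_axioms]
  note Vc = quot_by_ideal_carrier[OF module_axioms m.ideal_axioms]
  note Fc = FactRing_carrier_iff[OF module_axioms m.ideal_axioms]
  note Vs = quot_by_ideal_smult[OF module_axioms m.ideal_axioms]
  have one: "V.fin_dim \<and> V.dim \<le> 1" if y: "y \<in> carrier M" "adjoin ?I y = carrier M" for y
  proof -
    let ?Y = "?I +>\<^bsub>M\<^esub> y"
    have Y: "{?Y} \<subseteq> carrier ?V" using Vc y(1) by blast
    interpret S: LinearCombinations.submodule "R Quot \<mm>" "V.span {?Y}" ?V by (rule V.span_is_submodule[OF Y])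
    have YS: "?Y \<in> V.span {?Y}" using V.in_own_span[OF Y] by simp
    have "X \<in> V.span {?Y}" if X: "X \<in> carrier ?V" for X
    proof -
      obtain z where z: "z \<in> carrier M" "X = ?I +>\<^bsub>M\<^esub> z" using X unfolding Vc by (rule bexE)
      then have "z \<in> adjoin ?I y" using y(2) by simp
      then obtain n r where nr: "n \<in> ?I" "r \<in> carrier R" "z = n \<oplus>\<^bsub>M\<^esub> r \<odot>\<^bsub>M\<^esub> y"
        unfolding adjoin_iff by blast
      have "z \<in> ?I +>\<^bsub>M\<^esub> (r \<odot>\<^bsub>M\<^esub> y)" unfolding nr(3) a_r_coset_def' using nr(1) by blast
      then have "X = ?I +>\<^bsub>M\<^esub> (r \<odot>\<^bsub>M\<^esub> y)"
        unfolding z(2) by (rule submodule_coset_eq[OF module_axioms sI smult_closed[OF nr(2) y(1)]])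
      also have "\<dots> = (\<mm> +>\<^bsub>R\<^esub> r) \<odot>\<^bsub>?V\<^esub> ?Y" by (rule Vs[OF nr(2) y(1), symmetric])
      also have "\<dots> \<in> V.span {?Y}"
        by (rule S.smult_closed[OF _ YS]) (use Fc nr(2) in blast)
      finally show ?thesis .
    qed
    then have gen: "V.gen_set {?Y}" using S.subset by blast
    then have "V.fin_dim" unfolding V.fin_dim_def using Y by blast
    moreover have "V.dim \<le> card {?Y}" by (rule V.gen_ge_dim) (use Y gen in auto)
    ultimately show ?thesis by simp
  qed
  have two: "\<exists>y\<in>carrier M. adjoin ?I y = carrier M" if fd: "V.fin_dim" and dim: "V.dim \<le> 1"
  proof -
    have "\<exists>n A. finite A \<and> card A = n \<and> A \<subseteq> carrier ?V \<and> V.gen_set A"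
      using fd unfolding V.fin_dim_def by blast
    from LeastI_ex[OF this] obtain A where A: "finite A" "card A = V.dim" "A \<subseteq> carrier ?V" "V.gen_set A"
      unfolding V.dim_def by blast
    have "\<exists>Y\<in>carrier ?V. A \<subseteq> {Y}"
    proof (cases "A = {}")
      case True
      then show ?thesis using V.zero_closed by blast
    next
      case False
      then have "card A = 1" using A(1,2) dim card_gt_0_iff[of A] by linarith
      then show ?thesis using A(3) by (auto simp: card_1_singleton_iff)
    qed
    then obtain Y where Y: "Y \<in> carrier ?V" "A \<subseteq> {Y}" by blast
    obtain y where y: "y \<in> carrier M" "Y = ?I +>\<^bsub>M\<^esub> y" using Y(1) unfolding Vc by (rule bexE)
    let ?K = "{c \<odot>\<^bsub>?V\<^esub> Y |c. c \<in> carrier (R Quot \<mm>)}"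
    have "Y \<in> ?K" using V.smult_one[OF Y(1)] V.R.one_closed by (metis (mono_tags, lifting) mem_Collect_eq)
    then have sub: "V.span A \<subseteq> ?K"
      by (intro V.span_is_subset V.submod_cyclic Y(1)) (use Y(2) in blast)
    have "z \<in> adjoin ?I y" if z: "z \<in> carrier M" for z
    proof -
      have "?I +>\<^bsub>M\<^esub> z \<in> carrier ?V" unfolding Vc using z by blast
      then have "?I +>\<^bsub>M\<^esub> z \<in> ?K" using A(4) sub by blast
      then obtain c where c: "c \<in> carrier (R Quot \<mm>)" "?I +>\<^bsub>M\<^esub> z = c \<odot>\<^bsub>?V\<^esub> Y" by blast
      obtain r where r: "r \<in> carrier R" "c = \<mm> +>\<^bsub>R\<^esub> r" using c(1) unfolding Fc by (rule bexE)
      have "?I +>\<^bsub>M\<^esub> z = ?I +>\<^bsub>M\<^esub> (r \<odot>\<^bsub>M\<^esub> y)"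
        unfolding c(2) r(2) y(2) by (rule Vs[OF r(1) y(1)])
      then have "z \<in> ?I +>\<^bsub>M\<^esub> (r \<odot>\<^bsub>M\<^esub> y)" using submodule_mem_coset[OF module_axioms sI z] by simp
      then show ?thesis unfolding a_r_coset_def' adjoin_iff using r(1) by blast
    qed
    moreover have "adjoin ?I y \<subseteq> carrier M"
      by (rule LinearCombinations.submodule.subset[OF submod_adjoin[OF sI y(1)]])
    ultimately show ?thesis using y(1) by blast
  qed
  have "V.fin_dim \<and> V.dim \<le> 1 \<longleftrightarrow> (\<exists>y\<in>carrier M. adjoin ?I y = carrier M)"
    using one two by blast
  then show ?thesis unfolding noncyclic_maximal_ideals_def using True by auto
qed (simp add: noncyclic_maximal_ideals_def)

lemma submod_Union_chain:
  assumes C: "C \<noteq> {}" "subset.chain {N. submod N} C"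
  shows "submod (\<Union>C)"
proof -
  have s: "\<And>X. X \<in> C \<Longrightarrow> submod X" and lin: "\<And>X Y. X \<in> C \<Longrightarrow> Y \<in> C \<Longrightarrow> X \<subseteq> Y \<or> Y \<subseteq> X"
    using C(2) unfolding subset_chain_def by auto
  show ?thesis
  proof (rule LinearCombinations.submodule.intro[OF module_axioms])
    show "\<Union>C \<subseteq> carrier M" using LinearCombinations.submodule.subset[OF s] by blast
    show "\<zero>\<^bsub>M\<^esub> \<in> \<Union>C" using LinearCombinations.submodule.zero_closed[OF s] C(1) by blast
    show "v \<oplus>\<^bsub>M\<^esub> w \<in> \<Union>C" if vw: "v \<in> \<Union>C" "w \<in> \<Union>C" for v w
    proof -
      obtain X Y where "X \<in> C" "Y \<in> C" "v \<in> X" "w \<in> Y" using vw by auto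
      then obtain Z where "Z \<in> C" "v \<in> Z" "w \<in> Z" using lin by blast
      then show ?thesis using LinearCombinations.submodule.m_closed[OF s] by blast
    qed
    show "c \<odot>\<^bsub>M\<^esub> v \<in> \<Union>C" if "c \<in> carrier R" "v \<in> \<Union>C" for c v
      using that LinearCombinations.submodule.smult_closed[OF s] by blast
  qed
qed

text \<open>
  The existence of a hyperplane of the vector space \<open>M/\<mm>M\<close> that contains a given subspace and
  avoids a given vector: by Zorn's lemma there is a submodule that is maximal among those
  containing \<open>N\<close> and avoiding \<open>x\<close>, and \<open>x\<close> spans a complement of it modulo \<open>\<mm>M\<close>.
\<close>

lemma hyperplane_avoiding:
  assumes m: "maximalideal \<mm> R" and N: "submod N" "ideal_mult R M \<mm> \<subseteq> N" and x: "x \<in> carrier M" "x \<notin> N"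
  obtains P where "submod P" "N \<subseteq> P" "x \<notin> P" "adjoin P x = carrier M"
proof -
  let ?S = "{L. submod L \<and> N \<subseteq> L \<and> x \<notin> L}"
  have "\<exists>L\<in>?S. \<forall>X\<in>?S. L \<subseteq> X \<longrightarrow> X = L"
  proof (rule subset_Zorn_nonempty)
    show "?S \<noteq> {}" using N x by auto
    fix C assume C: "C \<noteq> {}" "subset.chain ?S C"
    then have CS: "C \<subseteq> ?S" unfolding subset_chain_def by auto
    have "subset.chain {N. submod N} C" using C(2) unfolding subset_chain_def by auto
    from submod_Union_chain[OF C(1) this] show "\<Union>C \<in> ?S" using CS C(1) by blast
  qed
  then obtain P where P: "submod P" "N \<subseteq> P" "x \<notin> P"
    and mx: "\<And>X. submod X \<Longrightarrow> N \<subseteq> X \<Longrightarrow> x \<notin> X \<Longrightarrow> P \<subseteq> X \<Longrightarrow> X = P" by auto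
  interpret P: LinearCombinations.submodule R P M by (rule P(1))
  note sPx = submod_adjoin[OF P(1) x(1)]
  interpret m: maximalideal \<mm> R by (rule m)
  have Im: "i \<odot>\<^bsub>M\<^esub> z \<in> P" if "i \<in> \<mm>" "z \<in> carrier M" for i z
    using ideal_mult_mem[OF module_axioms m.ideal_axioms that] N(2) P(2) by blast
  have "y \<in> adjoin P x" if y: "y \<in> carrier M" for y
  proof (cases "y \<in> P")
    case True
    then show ?thesis using subset_adjoin[OF P(1) x(1)] by blast
  next
    case False
    have "x \<in> adjoin P y"
    proof (rule ccontr)
      assume "x \<notin> adjoin P y"
      then have "adjoin P y = P"
        using mx[OF submod_adjoin[OF P(1) y]] subset_adjoin[OF P(1) y] P(2) by blast
      then show False using mem_adjoin[OF P(1) y] False by simp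
    qed
    then obtain p r where pr: "p \<in> P" "r \<in> carrier R" "x = p \<oplus>\<^bsub>M\<^esub> r \<odot>\<^bsub>M\<^esub> y" unfolding adjoin_iff by blast
    have rm: "r \<notin> \<mm>"
    proof
      assume "r \<in> \<mm>"
      then have "x \<in> P" unfolding pr(3) using P.m_closed[OF pr(1) Im] y by blast
      then show False using P(3) by blast
    qed
    have "p \<oplus>\<^bsub>M\<^esub> r \<odot>\<^bsub>M\<^esub> y \<in> adjoin P x" using mem_adjoin[OF P(1) x(1)] pr(3) by simp
    then have "r \<odot>\<^bsub>M\<^esub> y \<in> adjoin P x"
      using submod_add_mem_iff[OF sPx, of p "r \<odot>\<^bsub>M\<^esub> y"] subset_adjoin[OF P(1) x(1)] pr(1,2) y by auto
    then show ?thesis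
      using residue_cancel[OF m sPx y _ pr(2) rm] Im[OF _ y] subset_adjoin[OF P(1) x(1)] by blast
  qed
  then have "adjoin P x = carrier M" using LinearCombinations.submodule.subset[OF sPx] by blast
  then show ?thesis using that P by blast
qed

text \<open>
  Two hyperplanes \<open>P\<close>, \<open>Q\<close> of \<open>M/\<mm>M\<close> give \<open>M/W \<cong> (R/\<mm>)\<^sup>2\<close> for \<open>W = P \<inter> Q\<close>, with basis the
  classes of \<open>x \<in> Q\<close> and \<open>y \<in> P\<close>. The plane is the union of its lines through the origin: the
  line of \<open>x\<close>, whose preimage is \<open>Q\<close>, and one line of \<open>y + t x\<close> for each \<open>t \<in> R/\<mm>\<close>.
\<close>

lemma noncyclic_imp_small_cover:
  assumes mS: "\<mm> \<in> noncyclic_maximal_ideals R M"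
  obtains C where "C \<in> submodule_covers R M" "|C| \<le>o |carrier (R Quot \<mm>)| +c cone"
proof -
  have m: "maximalideal \<mm> R" and nc: "\<And>y. y \<in> carrier M \<Longrightarrow> adjoin (ideal_mult R M \<mm>) y \<noteq> carrier M"
    using mS unfolding noncyclic_maximal_ideals_iff by auto
  interpret m: maximalideal \<mm> R by (rule m)
  let ?I = "ideal_mult R M \<mm>"
  note sI = ideal_mult_submodule[OF module_axioms m.ideal_axioms]
  have Im: "i \<odot>\<^bsub>M\<^esub> z \<in> ?I" if "i \<in> \<mm>" "z \<in> carrier M" for i z
    by (rule ideal_mult_mem[OF module_axioms m.ideal_axioms that])
  have "?I \<noteq> carrier M"
    using nc[OF M.zero_closed] subset_adjoin[OF sI M.zero_closed]
      LinearCombinations.submodule.subset[OF submod_adjoin[OF sI M.zero_closed]] by blast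
  then obtain x where x: "x \<in> carrier M" "x \<notin> ?I"
    using LinearCombinations.submodule.subset[OF sI] by blast
  obtain P where P: "submod P" "?I \<subseteq> P" "x \<notin> P" "adjoin P x = carrier M"
    using hyperplane_avoiding[OF m sI subset_refl x] .
  interpret P: LinearCombinations.submodule R P M by (rule P(1))
  have "P \<noteq> ?I" using P(4) nc[OF x(1)] by auto
  then obtain y where y: "y \<in> P" "y \<notin> ?I" using P(2) by blast
  have yM: "y \<in> carrier M" using y(1) P.subset by blast
  have "y \<notin> adjoin ?I x"
  proof
    assume "y \<in> adjoin ?I x"
    then obtain u r where ur: "u \<in> ?I" "r \<in> carrier R" "y = u \<oplus>\<^bsub>M\<^esub> r \<odot>\<^bsub>M\<^esub> x" unfolding adjoin_iff by blast
    have uP: "u \<in> P" using ur(1) P(2) by blast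
    have "u \<oplus>\<^bsub>M\<^esub> r \<odot>\<^bsub>M\<^esub> x \<in> P" using y(1) ur(3) by simp
    then have "r \<odot>\<^bsub>M\<^esub> x \<in> P" using submod_add_mem_iff[OF P(1) uP smult_closed[OF ur(2) x(1)]] by simp
    then have "r \<in> \<mm>" using residue_cancel[OF m P(1) x(1) _ ur(2)] Im[OF _ x(1)] P(2,3) by blast
    then have "y \<in> ?I" unfolding ur(3)
      by (intro LinearCombinations.submodule.m_closed[OF sI] ur(1) Im x(1))
    then show False using y(2) by simp
  qed
  then obtain Q where Q: "submod Q" "adjoin ?I x \<subseteq> Q" "y \<notin> Q" "adjoin Q y = carrier M"
    using hyperplane_avoiding[OF m submod_adjoin[OF sI x(1)] subset_adjoin[OF sI x(1)] yM] by metis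
  interpret Q: LinearCombinations.submodule R Q M by (rule Q(1))
  have xQ: "x \<in> Q" using mem_adjoin[OF sI x(1)] Q(2) by blast
  have IQ: "?I \<subseteq> Q" using subset_adjoin[OF sI x(1)] Q(2) by blast
  let ?W = "P \<inter> Q"
  have sW: "submod ?W"
    by (rule LinearCombinations.submodule.intro[OF module_axioms]) (use P.subset in auto)
  let ?N = "\<lambda>t. adjoin ?W (y \<oplus>\<^bsub>M\<^esub> t \<odot>\<^bsub>M\<^esub> x)"
  have sN: "submod (?N t)" if "t \<in> carrier R" for t
    using submod_adjoin[OF sW] yM x(1) that by simp
  have xN: "x \<notin> ?N t" if t: "t \<in> carrier R" for t
  proof
    assume "x \<in> ?N t"
    then obtain w r where wr: "w \<in> ?W" "r \<in> carrier R" "x = w \<oplus>\<^bsub>M\<^esub> r \<odot>\<^bsub>M\<^esub> (y \<oplus>\<^bsub>M\<^esub> t \<odot>\<^bsub>M\<^esub> x)" unfolding adjoin_iff by blast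
    have c: "y \<oplus>\<^bsub>M\<^esub> t \<odot>\<^bsub>M\<^esub> x \<in> carrier M" using yM x(1) t by simp
    have "w \<oplus>\<^bsub>M\<^esub> r \<odot>\<^bsub>M\<^esub> (y \<oplus>\<^bsub>M\<^esub> t \<odot>\<^bsub>M\<^esub> x) \<in> Q" using xQ wr(3) by simp
    then have "r \<odot>\<^bsub>M\<^esub> (y \<oplus>\<^bsub>M\<^esub> t \<odot>\<^bsub>M\<^esub> x) \<in> Q"
      using submod_add_mem_iff[OF Q(1) _ smult_closed[OF wr(2) c]] wr(1) by blast
    moreover have "r \<odot>\<^bsub>M\<^esub> (y \<oplus>\<^bsub>M\<^esub> t \<odot>\<^bsub>M\<^esub> x) = r \<odot>\<^bsub>M\<^esub> (t \<odot>\<^bsub>M\<^esub> x) \<oplus>\<^bsub>M\<^esub> r \<odot>\<^bsub>M\<^esub> y"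
      using yM x(1) t wr(2) by (simp add: smult_r_distr M.a_comm)
    moreover have "r \<odot>\<^bsub>M\<^esub> (t \<odot>\<^bsub>M\<^esub> x) \<in> Q" using xQ t wr(2) by simp
    ultimately have "r \<odot>\<^bsub>M\<^esub> y \<in> Q"
      using submod_add_mem_iff[OF Q(1) _ smult_closed[OF wr(2) yM]] by simp
    then have "r \<in> \<mm>" using residue_cancel[OF m Q(1) yM _ wr(2)] Im[OF _ yM] IQ Q(3) by blast
    then have "r \<odot>\<^bsub>M\<^esub> (y \<oplus>\<^bsub>M\<^esub> t \<odot>\<^bsub>M\<^esub> x) \<in> P" using Im c P(2) by blast
    then have "w \<oplus>\<^bsub>M\<^esub> r \<odot>\<^bsub>M\<^esub> (y \<oplus>\<^bsub>M\<^esub> t \<odot>\<^bsub>M\<^esub> x) \<in> P" using wr(1) by blast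
    then show False using wr(3) P(3) by simp
  qed
  define rep where "rep A = (SOME t. t \<in> A)" for A :: "'a set"
  have rep: "rep (\<mm> +>\<^bsub>R\<^esub> r) \<in> \<mm> +>\<^bsub>R\<^esub> r" if "r \<in> carrier R" for r
    unfolding rep_def by (rule someI) (rule m.a_rcos_self[OF that])
  have repR: "rep A \<in> carrier R" if A: "A \<in> carrier (R Quot \<mm>)" for A
  proof -
    obtain r where r: "r \<in> carrier R" "A = \<mm> +>\<^bsub>R\<^esub> r"
      using A unfolding FactRing_carrier_iff[OF module_axioms m.ideal_axioms] by (rule bexE)
    show ?thesis unfolding r(2) using rep[OF r(1)] R.a_r_coset_subset_G[OF m.a_subset r(1)] by blast
  qed
  let ?C = "(\<lambda>A. ?N (rep A)) ` carrier (R Quot \<mm>) \<union> {Q}"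
  have "\<Union>?C = carrier M"
  proof
    show "\<Union>?C \<subseteq> carrier M" using Q.subset LinearCombinations.submodule.subset[OF sN[OF repR]] by blast
    show "carrier M \<subseteq> \<Union>?C"
    proof
      fix z assume z: "z \<in> carrier M"
      then have "z \<in> adjoin P x" using P(4) by simp
      then obtain p r where pr: "p \<in> P" "r \<in> carrier R" "z = p \<oplus>\<^bsub>M\<^esub> r \<odot>\<^bsub>M\<^esub> x"
        unfolding adjoin_iff by blast
      have pM: "p \<in> carrier M" using pr(1) P.subset by blast
      then have "p \<in> adjoin Q y" using Q(4) by simp
      then obtain q s where qs: "q \<in> Q" "s \<in> carrier R" "p = q \<oplus>\<^bsub>M\<^esub> s \<odot>\<^bsub>M\<^esub> y"
        unfolding adjoin_iff by blast
      have qM: "q \<in> carrier M" using qs(1) Q.subset by blast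
      show "z \<in> \<Union>?C"
      proof (cases "s \<in> \<mm>")
        case True
        then have "s \<odot>\<^bsub>M\<^esub> y \<in> Q" using Im yM IQ by blast
        then have "p \<in> Q" unfolding qs(3) using qs(1) by simp
        then have "z \<in> Q" unfolding pr(3) using pr(2) xQ by simp
        then show ?thesis by blast
      next
        case False
        have "s \<odot>\<^bsub>M\<^esub> y \<oplus>\<^bsub>M\<^esub> q \<in> P" using pr(1) qM qs(2) yM unfolding qs(3) by (simp add: M.a_comm)
        then have "q \<in> P" using submod_add_mem_iff[OF P(1) P.smult_closed[OF qs(2) y(1)] qM] by simp
        obtain u i where ui: "u \<in> carrier R" "i \<in> \<mm>" "i \<oplus> u \<otimes> s = \<one>"
          using maximalideal_inverse[OF m qs(2) False] .
        have iR: "i \<in> carrier R" using ui(2) m.a_subset by blast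
        let ?A = "\<mm> +>\<^bsub>R\<^esub> (u \<otimes> r)"
        let ?t = "rep ?A"
        have A: "?A \<in> carrier (R Quot \<mm>)"
          using FactRing_carrier_iff[OF module_axioms m.ideal_axioms] ui(1) pr(2) by blast
        obtain j where j: "j \<in> \<mm>" "?t = j \<oplus> u \<otimes> r"
          using rep[of "u \<otimes> r"] ui(1) pr(2) unfolding a_r_coset_def' by auto
        have jR: "j \<in> carrier R" using j(1) m.a_subset by blast
        have tR: "?t \<in> carrier R" by (rule repR[OF A])
        (* Since i \<equiv> 0 and u s \<equiv> 1 modulo \<mm>, the coordinates (s, r) of z are s times (1, t) modulo \<mm>;
           k = r - s t is the error, and k x lies in W. *)
        define k where "k = i \<otimes> r \<ominus> s \<otimes> j"
        have km: "k \<in> \<mm>" unfolding k_def a_minus_def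
          by (intro m.a_closed m.a_inv_closed m.I_r_closed m.I_l_closed ui j pr qs)
        then have kR: "k \<in> carrier R" using m.a_subset by blast
        have "k \<oplus> s \<otimes> ?t = (i \<oplus> u \<otimes> s) \<otimes> r"
          unfolding j(2) k_def using iR jR ui(1) pr(2) qs(2) by algebra
        then have r: "r = k \<oplus> s \<otimes> ?t" using ui(3) pr(2) by simp
        have "r \<odot>\<^bsub>M\<^esub> x = k \<odot>\<^bsub>M\<^esub> x \<oplus>\<^bsub>M\<^esub> s \<odot>\<^bsub>M\<^esub> (?t \<odot>\<^bsub>M\<^esub> x)"
          by (subst r) (use kR qs(2) tR x(1) in \<open>simp add: smult_l_distr smult_assoc1\<close>)
        then have "z = (q \<oplus>\<^bsub>M\<^esub> k \<odot>\<^bsub>M\<^esub> x) \<oplus>\<^bsub>M\<^esub> s \<odot>\<^bsub>M\<^esub> (y \<oplus>\<^bsub>M\<^esub> ?t \<odot>\<^bsub>M\<^esub> x)"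
          unfolding pr(3) qs(3) using qM kR qs(2) tR x(1) yM by (simp add: smult_r_distr M.a_ac)
        moreover have "q \<oplus>\<^bsub>M\<^esub> k \<odot>\<^bsub>M\<^esub> x \<in> ?W"
          using \<open>q \<in> P\<close> qs(1) Im[OF km x(1)] P(2) IQ by blast
        ultimately have "z \<in> ?N ?t" unfolding adjoin_iff using qs(2) by blast
        then show ?thesis using A by blast
      qed
    qed
  qed
  moreover have "\<forall>N\<in>?C. submod N \<and> N \<noteq> carrier M"
    using sN[OF repR] xN[OF repR] x(1) Q(1,3) yM by blast
  ultimately have "?C \<in> submodule_covers R M" unfolding submodule_covers_def by blast
  moreover have "|?C| \<le>o |carrier (R Quot \<mm>)| +c cone"
    by (rule ordLeq_transitive[OF Un_csum csum_mono]) (simp_all add: cone_def card_of_image card_of_singl_ordLeq)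
  ultimately show ?thesis using that by blast
qed

section \<open>Avoiding few submodules\<close>

text \<open>
  The points \<open>w\<close> and \<open>x + t w\<close>, with \<open>t\<close> in a set of representatives of \<open>R/\<mm>\<close>, number
  \<open>|R/\<mm>| + 1\<close>. A submodule containing two of them contains \<open>x\<close> and \<open>w\<close>, because the difference of
  two distinct representatives can be divided out. If every point lay in a member of \<open>\<C>\<close> that
  does not contain both \<open>x\<close> and \<open>w\<close>, then choosing such a member for each point would be an
  injection of the set of points into \<open>\<C>\<close>. This works for finite and infinite \<open>R/\<mm>\<close> alike.
\<close>

lemma pencil_point:
  assumes m: "maximalideal \<mm> R" and x: "x \<in> carrier M" and w: "w \<in> carrier M"
    and C: "\<And>N. N \<in> \<C> \<Longrightarrow> submod N" "\<And>N i. N \<in> \<C> \<Longrightarrow> i \<in> \<mm> \<Longrightarrow> i \<odot>\<^bsub>M\<^esub> w \<in> N"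
    and small: "\<not> |carrier (R Quot \<mm>)| +c cone \<le>o |\<C>|"
  shows "\<exists>p. (p = w \<or> (\<exists>t\<in>carrier R. p = x \<oplus>\<^bsub>M\<^esub> t \<odot>\<^bsub>M\<^esub> w)) \<and> (\<forall>N\<in>\<C>. p \<in> N \<longrightarrow> x \<in> N \<and> w \<in> N)"
proof (rule ccontr)
  assume contr: "\<not> ?thesis"
  interpret m: maximalideal \<mm> R by (rule m)
  define rep where "rep A = (SOME t. t \<in> carrier R \<and> A = \<mm> +>\<^bsub>R\<^esub> t)" for A :: "'a set"
  have rep: "rep A \<in> carrier R" "A = \<mm> +>\<^bsub>R\<^esub> rep A" if A: "A \<in> carrier (R Quot \<mm>)" for A
  proof -
    have "\<exists>t. t \<in> carrier R \<and> A = \<mm> +>\<^bsub>R\<^esub> t"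
      using A unfolding FactRing_carrier_iff[OF module_axioms m.ideal_axioms] by blast
    from someI_ex[OF this] show "rep A \<in> carrier R" "A = \<mm> +>\<^bsub>R\<^esub> rep A" unfolding rep_def by blast+
  qed
  let ?I = "carrier (R Quot \<mm>) <+> {()}"
  define pt where "pt a = (case a of Inl A \<Rightarrow> x \<oplus>\<^bsub>M\<^esub> rep A \<odot>\<^bsub>M\<^esub> w | Inr _ \<Rightarrow> w)" for a :: "'a set + unit"
  have pt_Inl: "pt (Inl A) = x \<oplus>\<^bsub>M\<^esub> rep A \<odot>\<^bsub>M\<^esub> w" and pt_Inr: "pt (Inr u) = w" for A u
    unfolding pt_def by simp_all
  have bad: "\<exists>N. N \<in> \<C> \<and> pt a \<in> N \<and> \<not> (x \<in> N \<and> w \<in> N)" if "a \<in> ?I" for a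
  proof -
    have "pt a = w \<or> (\<exists>t\<in>carrier R. pt a = x \<oplus>\<^bsub>M\<^esub> t \<odot>\<^bsub>M\<^esub> w)"
      using that rep(1) by (auto simp: pt_Inl pt_Inr)
    then show ?thesis using contr by blast
  qed
  then obtain h where h: "\<And>a. a \<in> ?I \<Longrightarrow> h a \<in> \<C> \<and> pt a \<in> h a \<and> \<not> (x \<in> h a \<and> w \<in> h a)" by metis
  have x_of_w: "x \<in> N" if N: "N \<in> \<C>" "w \<in> N" "x \<oplus>\<^bsub>M\<^esub> t \<odot>\<^bsub>M\<^esub> w \<in> N" "t \<in> carrier R" for N t
  proof -
    have "t \<odot>\<^bsub>M\<^esub> w \<in> N" using LinearCombinations.submodule.smult_closed[OF C(1)[OF N(1)] N(4,2)] .
    moreover have "t \<odot>\<^bsub>M\<^esub> w \<oplus>\<^bsub>M\<^esub> x \<in> N" using N(3,4) x w by (simp add: M.a_comm)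
    ultimately show ?thesis using submod_add_mem_iff[OF C(1)[OF N(1)] _ x] by simp
  qed
  have two: "x \<in> N \<and> w \<in> N" if N: "N \<in> \<C>" and ab: "a \<in> ?I" "b \<in> ?I" "a \<noteq> b" "pt a \<in> N" "pt b \<in> N" for N a b
  proof -
    consider A where "a = Inl A" "A \<in> carrier (R Quot \<mm>)" "b = Inr ()"
      | A where "b = Inl A" "A \<in> carrier (R Quot \<mm>)" "a = Inr ()"
      | A B where "a = Inl A" "A \<in> carrier (R Quot \<mm>)" "b = Inl B" "B \<in> carrier (R Quot \<mm>)" "A \<noteq> B"
      using ab(1-3) by (elim PlusE) auto
    then show ?thesis
    proof cases
      case 1
      then show ?thesis using x_of_w[OF N _ _ rep(1)] ab(4,5) by (simp add: pt_Inl pt_Inr)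
    next
      case 2
      then show ?thesis using x_of_w[OF N _ _ rep(1)] ab(4,5) by (simp add: pt_Inl pt_Inr)
    next
      case 3
      let ?s = "rep A" and ?t = "rep B"
      have st: "?s \<in> carrier R" "?t \<in> carrier R" using rep(1) 3 by auto
      have ptN: "x \<oplus>\<^bsub>M\<^esub> ?s \<odot>\<^bsub>M\<^esub> w \<in> N" "x \<oplus>\<^bsub>M\<^esub> ?t \<odot>\<^bsub>M\<^esub> w \<in> N" using ab(4,5) 3 by (simp_all add: pt_Inl)
      have nm: "?s \<ominus> ?t \<notin> \<mm>"
      proof
        assume "?s \<ominus> ?t \<in> \<mm>"
        moreover have "(?s \<ominus> ?t) \<oplus> ?t = ?s" using st by algebra
        ultimately have "?s \<in> \<mm> +>\<^bsub>R\<^esub> ?t" unfolding a_r_coset_def' by force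
        then have "\<mm> +>\<^bsub>R\<^esub> ?s = \<mm> +>\<^bsub>R\<^esub> ?t" using m.a_repr_independence' st by simp
        then show False using rep(2) 3 by metis
      qed
      have "(x \<oplus>\<^bsub>M\<^esub> ?t \<odot>\<^bsub>M\<^esub> w) \<oplus>\<^bsub>M\<^esub> (?s \<ominus> ?t) \<odot>\<^bsub>M\<^esub> w = x \<oplus>\<^bsub>M\<^esub> (?t \<oplus> (?s \<ominus> ?t)) \<odot>\<^bsub>M\<^esub> w"
        using st x w by (simp add: smult_l_distr M.a_assoc)
      also have "?t \<oplus> (?s \<ominus> ?t) = ?s" using st by algebra
      finally have "(?s \<ominus> ?t) \<odot>\<^bsub>M\<^esub> w \<in> N"
        using submod_add_mem_iff[OF C(1)[OF N] ptN(2), of "(?s \<ominus> ?t) \<odot>\<^bsub>M\<^esub> w"] ptN(1) st w by simp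
      then have "w \<in> N" using residue_cancel[OF m C(1)[OF N] w C(2)[OF N] _ nm] st by simp
      then show ?thesis using x_of_w[OF N _ ptN(1) st(1)] by simp
    qed
  qed
  have "inj_on h ?I"
    by (rule inj_onI) (metis h two)
  moreover have "h ` ?I \<subseteq> \<C>" using h by blast
  ultimately have "|?I| \<le>o |\<C>|" using card_of_ordLeq by blast
  moreover have "|carrier (R Quot \<mm>)| +c cone =o |?I|"
    unfolding cone_def by (rule ordIso_symmetric[OF Plus_csum])
  ultimately show False using small ordIso_ordLeq_trans by blast
qed

lemma ideal_mult_quot_ann_subset:
  assumes "maximal_submodule R M P"
  shows "ideal_mult R M (quot_ann P) \<subseteq> P"
  unfolding ideal_mult_def
  by (rule span_is_subset[OF _ maximal_submoduleD(1)[OF assms]]) (auto simp: quot_ann_def)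

text \<open>
  Two distinct maximal submodules of the same type \<open>\<mm>\<close> give two independent linear forms on
  \<open>M/\<mm>M\<close>. In detail, if \<open>M = \<mm>M + Ry\<close>, let \<open>r\<close>, \<open>s\<close> be the coordinates of \<open>u\<close>, \<open>w\<close> along \<open>y\<close>.
  Then \<open>s u - r w \<in> \<mm>M \<subseteq> P\<close>, and \<open>w \<in> P\<close>, so \<open>s u \<in> P\<close> and \<open>s \<in> \<mm>\<close>. This puts \<open>w\<close> into
  \<open>\<mm>M \<subseteq> Q\<close>.
\<close>

lemma same_quot_ann_imp_noncyclic:
  assumes P: "maximal_submodule R M P" and Q: "maximal_submodule R M Q"
    and eq: "quot_ann P = quot_ann Q"
    and u: "u \<in> carrier M" "u \<notin> P" and w: "w \<in> P" "w \<notin> Q"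
  shows "quot_ann Q \<in> noncyclic_maximal_ideals R M"
  unfolding noncyclic_maximal_ideals_iff
proof (intro conjI ballI notI)
  let ?m = "quot_ann Q"
  let ?I = "ideal_mult R M ?m"
  note sP = maximal_submoduleD(1)[OF P]
  note sQ = maximal_submoduleD(1)[OF Q]
  interpret P: LinearCombinations.submodule R P M by (rule sP)
  show "maximalideal ?m R" by (rule quot_ann_maximalideal[OF Q])
  then interpret m: maximalideal ?m R .
  have IP: "?I \<subseteq> P" using ideal_mult_quot_ann_subset[OF P] eq by simp
  have IQ: "?I \<subseteq> Q" by (rule ideal_mult_quot_ann_subset[OF Q])
  have wM: "w \<in> carrier M" using w(1) P.subset by blast
  fix y assume y: "y \<in> carrier M" "adjoin ?I y = carrier M"
  have "u \<in> adjoin ?I y" using u(1) y(2) by simp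
  then obtain c r where cr: "c \<in> ?I" "r \<in> carrier R" "u = c \<oplus>\<^bsub>M\<^esub> r \<odot>\<^bsub>M\<^esub> y" unfolding adjoin_iff by blast
  have "w \<in> adjoin ?I y" using wM y(2) by simp
  then obtain d s where ds: "d \<in> ?I" "s \<in> carrier R" "w = d \<oplus>\<^bsub>M\<^esub> s \<odot>\<^bsub>M\<^esub> y" unfolding adjoin_iff by blast
  have cP: "c \<in> P" and dP: "d \<in> P" using cr(1) ds(1) IP by blast+
  then have cM: "c \<in> carrier M" and dM: "d \<in> carrier M" using P.subset by blast+
  have rs: "s \<odot>\<^bsub>M\<^esub> (r \<odot>\<^bsub>M\<^esub> y) = r \<odot>\<^bsub>M\<^esub> (s \<odot>\<^bsub>M\<^esub> y)"
    using cr(2) ds(2) y(1) by (simp flip: smult_assoc1 add: R.m_comm)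
  have "r \<odot>\<^bsub>M\<^esub> d \<oplus>\<^bsub>M\<^esub> s \<odot>\<^bsub>M\<^esub> u = s \<odot>\<^bsub>M\<^esub> c \<oplus>\<^bsub>M\<^esub> r \<odot>\<^bsub>M\<^esub> w"
    unfolding cr(3) ds(3) using cr(2) ds(2) cM dM y(1) by (simp add: smult_r_distr rs M.a_ac)
  moreover have "s \<odot>\<^bsub>M\<^esub> c \<oplus>\<^bsub>M\<^esub> r \<odot>\<^bsub>M\<^esub> w \<in> P" using cP w(1) cr(2) ds(2) by simp
  ultimately have "s \<odot>\<^bsub>M\<^esub> u \<in> P"
    using submod_add_mem_iff[OF sP P.smult_closed[OF cr(2) dP] smult_closed[OF ds(2) u(1)]] by simp
  then have "s \<in> ?m" using quot_ann_iff[OF P u ds(2)] eq by simp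
  then have "s \<odot>\<^bsub>M\<^esub> y \<in> ?I" by (rule ideal_mult_mem[OF module_axioms m.ideal_axioms _ y(1)])
  then have "w \<in> Q" unfolding ds(3)
    using LinearCombinations.submodule.m_closed[OF sQ] ds(1) IQ by blast
  then show False using w(2) by simp
qed

text \<open>
  None of the finitely many maximal ideals is contained in \<open>\<mm>\<close>, and \<open>\<mm>\<close> is prime, so a product of
  witnesses works.
\<close>

lemma exists_multiplier_avoiding:
  assumes m: "maximalideal \<mm> R" and fin: "finite \<I>"
    and I: "\<And>I. I \<in> \<I> \<Longrightarrow> maximalideal I R" "\<mm> \<notin> \<I>"
  shows "\<exists>b\<in>carrier R. b \<notin> \<mm> \<and> (\<forall>I\<in>\<I>. b \<in> I)"
  using fin I
proof (induction \<I> rule: finite_induct)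
  case empty
  have "\<one> \<notin> \<mm>"
    using ideal.one_imp_carrier[OF maximalideal.axioms(1)[OF m]] maximalideal.I_notcarr[OF m] by auto
  then show ?case by blast
next
  case (insert I \<I>)
  then obtain b where b: "b \<in> carrier R" "b \<notin> \<mm>" "\<And>I. I \<in> \<I> \<Longrightarrow> b \<in> I" by blast
  interpret m: maximalideal \<mm> R by (rule m)
  interpret I: maximalideal I R using insert.prems(1) by simp
  interpret p: primeideal \<mm> R by (rule maximalideal_prime[OF m])
  have "\<not> I \<subseteq> \<mm>"
    using I.I_maximal[OF m.ideal_axioms _ m.a_subset] m.I_notcarr insert.prems(2) by auto
  then obtain a where a: "a \<in> I" "a \<notin> \<mm>" by blast
  have aR: "a \<in> carrier R" using a(1) I.a_subset by blast
  have "a \<otimes> b \<notin> \<mm>" using p.I_prime[OF aR b(1)] a(2) b(2) by blast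
  moreover have "a \<otimes> b \<in> I'" if I': "I' \<in> insert I \<I>" for I'
  proof (cases "I' = I")
    case True
    then show ?thesis using I.I_r_closed[OF a(1) b(1)] by simp
  next
    case False
    then have "b \<in> I'" "ideal I' R" using I' b(3) insert.prems(1) maximalideal.axioms(1) by auto
    then show ?thesis using ideal.I_l_closed aR by metis
  qed
  ultimately show ?case using aR b(1) by blast
qed

text \<open>
  Call \<open>x\<close> generic for \<open>\<Q> \<subseteq> \<P>\<close> if every \<open>N \<in> \<C>\<close> containing \<open>x\<close> contains \<open>v P\<close> for all
  \<open>P \<in> \<Q>\<close>. An element generic for \<open>\<P>\<close> lies in no proper submodule of \<open>\<C>\<close>, since these contain
  the intersection of \<open>\<P>\<close>, which together with the \<open>v P\<close> generates \<open>M\<close>. Such an element is built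
  by adding one \<open>Q\<close> at a time: it suffices to find a combination of \<open>x\<close> and \<open>w = v Q\<close> such that
  every \<open>N\<close> containing it contains both \<open>x\<close> and \<open>w\<close>. If the type of \<open>Q\<close> is in \<open>S\<^sub>M\<close>, the pencil
  spanned by \<open>x\<close> and \<open>w\<close> has such a point by the bound on \<open>\<C>\<close>. Otherwise all other types differ
  from that of \<open>Q\<close>, and \<open>x + w\<close> works: a multiplier kills \<open>x\<close> but not \<open>w\<close> modulo the intersection.
\<close>

lemma exists_outside_few_submodules:
  assumes dual: "dual_family \<P> v"
    and C: "\<And>N. N \<in> \<C> \<Longrightarrow> submod N" "\<And>N. N \<in> \<C> \<Longrightarrow> carrier M \<inter> \<Inter>\<P> \<subseteq> N" "\<And>N. N \<in> \<C> \<Longrightarrow> N \<noteq> carrier M"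
    and small: "\<And>\<mm>. \<mm> \<in> noncyclic_maximal_ideals R M \<Longrightarrow> \<not> |carrier (R Quot \<mm>)| +c cone \<le>o |\<C>|"
  shows "\<exists>x\<in>carrier M. x \<notin> \<Union>\<C>"
proof -
  let ?J = "carrier M \<inter> \<Inter>\<P>"
  have fin: "finite \<P>" and max: "P \<in> \<P> \<Longrightarrow> maximal_submodule R M P"
    and v: "P \<in> \<P> \<Longrightarrow> v P \<in> carrier M" "P \<in> \<P> \<Longrightarrow> v P \<notin> P"
      "P \<in> \<P> \<Longrightarrow> Q \<in> \<P> \<Longrightarrow> Q \<noteq> P \<Longrightarrow> v P \<in> Q" for P Q
    using dual unfolding dual_family_def by auto
  note sub = maximal_submoduleD(1)[OF max]
  (* The condition on \<P> - \<Q> is what lets a multiplier vanishing on the types in \<Q> send x into the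
     intersection of all of \<P>. *)
  have "\<exists>x\<in>carrier M. (\<forall>P\<in>\<P> - \<Q>. x \<in> P) \<and> (\<forall>N\<in>\<C>. x \<in> N \<longrightarrow> v ` \<Q> \<subseteq> N)" if "\<Q> \<subseteq> \<P>" for \<Q>
    using finite_subset[OF that fin] that
  proof (induction \<Q> rule: finite_induct)
    case empty
    then show ?case using LinearCombinations.submodule.zero_closed[OF sub] M.zero_closed by blast
  next
    case (insert Q \<Q>)
    then obtain x where x: "x \<in> carrier M" "\<And>P. P \<in> \<P> \<Longrightarrow> P \<notin> \<Q> \<Longrightarrow> x \<in> P"
      "\<And>N. N \<in> \<C> \<Longrightarrow> x \<in> N \<Longrightarrow> v ` \<Q> \<subseteq> N" by auto
    have Q: "Q \<in> \<P>" "Q \<notin> \<Q>" and QP: "\<Q> \<subseteq> \<P>" using insert by auto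
    let ?m = "quot_ann Q" and ?w = "v Q"
    note w = v(1,2)[OF Q(1)]
    have wP: "?w \<in> P" if "P \<in> \<P>" "P \<noteq> Q" for P using v(3)[OF Q(1) that] .
    have m: "maximalideal ?m R" by (rule quot_ann_maximalideal[OF max[OF Q(1)]])
    have mw: "i \<odot>\<^bsub>M\<^esub> ?w \<in> N" if i: "i \<in> ?m" and N: "N \<in> \<C>" for i N
    proof -
      have iR: "i \<in> carrier R" and iQ: "i \<odot>\<^bsub>M\<^esub> ?w \<in> Q" using i w(1) unfolding quot_ann_def by auto
      have "i \<odot>\<^bsub>M\<^esub> ?w \<in> P" if P: "P \<in> \<P>" for P
        using LinearCombinations.submodule.smult_closed[OF sub[OF P] iR] wP[OF P] iQ by blast
      then have "i \<odot>\<^bsub>M\<^esub> ?w \<in> ?J" using iR w(1) by blast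
      then show ?thesis using C(2)[OF N] by blast
    qed
    (* w and the x + t w lie in every P outside insert Q \<Q>, so any of them keeps that invariant. *)
    have "\<exists>p. (p = ?w \<or> (\<exists>t\<in>carrier R. p = x \<oplus>\<^bsub>M\<^esub> t \<odot>\<^bsub>M\<^esub> ?w)) \<and> (\<forall>N\<in>\<C>. p \<in> N \<longrightarrow> x \<in> N \<and> ?w \<in> N)"
    proof (cases "?m \<in> noncyclic_maximal_ideals R M")
      case True
      show ?thesis by (rule pencil_point[OF m x(1) w(1) C(1) mw small[OF True]])
    next
      case False
      have "quot_ann P \<noteq> ?m" if P: "P \<in> \<Q>" for P
      proof
        assume eq: "quot_ann P = ?m"
        have P': "P \<in> \<P>" "P \<noteq> Q" using P Q QP by auto
        show False
          using same_quot_ann_imp_noncyclic[OF max[OF P'(1)] max[OF Q(1)] eq v(1,2)[OF P'(1)] wP[OF P'] w(2)] False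
          by simp
      qed
      then have nQ: "?m \<notin> quot_ann ` \<Q>" by (auto dest: sym)
      have "maximalideal I R" if "I \<in> quot_ann ` \<Q>" for I
        using that quot_ann_maximalideal[OF max] QP by blast
      from exists_multiplier_avoiding[OF m finite_imageI[OF insert.hyps(1)] this nQ]
      obtain b where b: "b \<in> carrier R" "b \<notin> ?m" "\<And>P. P \<in> \<Q> \<Longrightarrow> b \<in> quot_ann P" by blast
      have bx: "b \<odot>\<^bsub>M\<^esub> x \<in> N" if N: "N \<in> \<C>" for N
      proof -
        have "b \<odot>\<^bsub>M\<^esub> x \<in> P" if P: "P \<in> \<P>" for P
        proof (cases "P \<in> \<Q>")
          case True
          then show ?thesis using b(3) x(1) unfolding quot_ann_def by blast
        next
          case False
          then show ?thesis using LinearCombinations.submodule.smult_closed[OF sub[OF P] b(1)] x(2) P by blast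
        qed
        then have "b \<odot>\<^bsub>M\<^esub> x \<in> ?J" using b(1) x(1) by blast
        then show ?thesis using C(2)[OF N] by blast
      qed
      (* The point x + w, written with t = \<one> to match the shape of the pencil. *)
      have "x \<in> N \<and> ?w \<in> N" if N: "N \<in> \<C>" and p: "x \<oplus>\<^bsub>M\<^esub> \<one> \<odot>\<^bsub>M\<^esub> ?w \<in> N" for N
      proof -
        note sN = C(1)[OF N]
        have p': "x \<oplus>\<^bsub>M\<^esub> ?w \<in> N" using p w(1) by simp
        have "b \<odot>\<^bsub>M\<^esub> x \<oplus>\<^bsub>M\<^esub> b \<odot>\<^bsub>M\<^esub> ?w \<in> N"
          using LinearCombinations.submodule.smult_closed[OF sN b(1) p'] b(1) x(1) w(1) by (simp add: smult_r_distr)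
        then have "b \<odot>\<^bsub>M\<^esub> ?w \<in> N"
          using submod_add_mem_iff[OF sN bx[OF N] smult_closed[OF b(1) w(1)]] by simp
        then have wN: "?w \<in> N" using residue_cancel[OF m sN w(1) mw[OF _ N] b(1,2)] by simp
        have "?w \<oplus>\<^bsub>M\<^esub> x \<in> N" using p' x(1) w(1) by (simp add: M.a_comm)
        then show ?thesis using submod_add_mem_iff[OF sN wN x(1)] wN by simp
      qed
      then show ?thesis using R.one_closed by blast
    qed
    then obtain p where p: "p = ?w \<or> (\<exists>t\<in>carrier R. p = x \<oplus>\<^bsub>M\<^esub> t \<odot>\<^bsub>M\<^esub> ?w)"
      and pN: "\<And>N. N \<in> \<C> \<Longrightarrow> p \<in> N \<Longrightarrow> x \<in> N \<and> ?w \<in> N" by blast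
    have pM: "p \<in> carrier M" using p x(1) w(1) by auto
    have "p \<in> P" if P: "P \<in> \<P>" "P \<notin> insert Q \<Q>" for P
    proof -
      interpret P: LinearCombinations.submodule R P M by (rule sub[OF P(1)])
      have "x \<in> P" "?w \<in> P" using x(2) wP P by auto
      then show ?thesis using p by auto
    qed
    moreover have "v ` insert Q \<Q> \<subseteq> N" if N: "N \<in> \<C>" "p \<in> N" for N
      using pN[OF N] x(3)[OF N(1)] by auto
    ultimately show ?case using pM by blast
  qed
  from this[OF subset_refl]
  obtain x where x: "x \<in> carrier M" and "(\<forall>P\<in>\<P> - \<P>. x \<in> P) \<and> (\<forall>N\<in>\<C>. x \<in> N \<longrightarrow> v ` \<P> \<subseteq> N)"
    by (rule bexE)
  then have xN: "v ` \<P> \<subseteq> N" if "N \<in> \<C>" "x \<in> N" for N using that by simp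
  have "x \<notin> N" if N: "N \<in> \<C>" for N
  proof
    assume "x \<in> N"
    then have vN: "\<And>P. P \<in> \<P> \<Longrightarrow> v P \<in> N" using xN[OF N] by blast
    have "N = carrier M"
      by (rule dual_family_generates[OF dual C(1)[OF N] C(2)[OF N] vN])
    then show False using C(3)[OF N] by blast
  qed
  then show ?thesis using x by blast
qed

text \<open>
  Replacing each \<open>N\<close> by \<open>J(M) + N\<close> keeps it proper, as \<open>J(M)\<close> is small, keeps the union equal to
  \<open>M\<close>, and does not increase the number of submodules.
\<close>

lemma submodule_cover_lower_bound:
  assumes J: "small_submodule R M (jacobson_radical R M)" and d: "dual_goldie_dim R M < \<infinity>"
    and C: "\<C> \<in> submodule_covers R M"
  shows "\<exists>\<mm>\<in>noncyclic_maximal_ideals R M. |carrier (R Quot \<mm>)| +c cone \<le>o |\<C>|"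
proof (rule ccontr)
  assume contr: "\<not> ?thesis"
  obtain \<P> v where dual: "dual_family \<P> v" and JP: "jacobson_radical R M = carrier M \<inter> \<Inter>\<P>"
    using jacobson_radical_dual_family[OF d] .
  let ?J = "jacobson_radical R M"
  let ?D = "(\<lambda>N. ?J <+>\<^bsub>M\<^esub> N) ` \<C>"
  have sJ: "submod ?J" by (rule jacobson_radical_submodule[OF module_axioms])
  have sC: "submod N" "N \<noteq> carrier M" if "N \<in> \<C>" for N using C that unfolding submodule_covers_def by auto
  have "\<exists>x\<in>carrier M. x \<notin> \<Union>?D"
  proof (rule exists_outside_few_submodules[OF dual])
    fix N assume "N \<in> ?D"
    then obtain K where K: "K \<in> \<C>" "N = ?J <+>\<^bsub>M\<^esub> K" by blast
    note sK = sC[OF K(1)]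
    show "submod N" unfolding K(2) by (rule submod_set_add[OF sJ sK(1)])
    show "carrier M \<inter> \<Inter>\<P> \<subseteq> N" unfolding K(2) JP[symmetric] by (rule submod_subset_set_add(1)[OF sJ sK(1)])
    show "N \<noteq> carrier M" unfolding K(2) using J sK unfolding small_submodule_def by blast
  next
    fix \<mm> assume "\<mm> \<in> noncyclic_maximal_ideals R M"
    then show "\<not> |carrier (R Quot \<mm>)| +c cone \<le>o |?D|"
      using contr ordLeq_transitive[OF _ card_of_image] by blast
  qed
  then obtain x where x: "x \<in> carrier M" "x \<notin> \<Union>?D" by blast
  have "x \<in> \<Union>\<C>" using x(1) C unfolding submodule_covers_def by blast
  then obtain N where N: "N \<in> \<C>" "x \<in> N" by blast
  then have "x \<in> ?J <+>\<^bsub>M\<^esub> N" using submod_subset_set_add(2)[OF sJ sC(1)[OF N(1)]] by blast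
  then show False using x(2) N(1) by blast
qed

end

section \<open>The covering number\<close>

theorem theorem3p2:
  fixes R :: "('r, 'k) ring_scheme" and M :: "('r, 'm, 'l) module_scheme"
  assumes "Module.module R M"
    and "small_submodule R M (jacobson_radical R M)"
    and "dual_goldie_dim R M < \<infinity>"
  shows "(noncyclic_maximal_ideals R M = {} \<and> finitely_generated R M \<longrightarrow>
            cyclic_module R M \<and> submodule_covers R M = {}) \<and>
         (noncyclic_maximal_ideals R M \<noteq> {} \<longrightarrow>
            submodule_covers R M \<noteq> {} \<and>
            covering_number R M =o
              min_card {carrier (R Quot \<mm>) |\<mm>. \<mm> \<in> noncyclic_maximal_ideals R M} +c cone)"
proof -
  interpret Module.module R M by (rule assms(1))
  let ?S = "noncyclic_maximal_ideals R M"
  note lower = submodule_cover_lower_bound[OF assms(2,3)]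
  have "cyclic_module R M \<and> submodule_covers R M = {}" if S: "?S = {}"
  proof
    show nocover: "submodule_covers R M = {}" using lower S by blast
    let ?C = "{N. submod N \<and> N \<noteq> carrier M}"
    have "\<Union>?C \<noteq> carrier M"
    proof
      assume "\<Union>?C = carrier M"
      then have "?C \<in> submodule_covers R M" unfolding submodule_covers_def by simp
      then show False using nocover by simp
    qed
    moreover have "\<Union>?C \<subseteq> carrier M" using LinearCombinations.submodule.subset by blast
    ultimately obtain x where x: "x \<in> carrier M" "x \<notin> \<Union>?C" by blast
    have "x \<in> {r \<odot>\<^bsub>M\<^esub> x |r. r \<in> carrier R}"
      using smult_one[OF x(1)] R.one_closed by (metis (mono_tags, lifting) mem_Collect_eq)
    then have "carrier M = {r \<odot>\<^bsub>M\<^esub> x |r. r \<in> carrier R}"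
      using submod_cyclic[OF x(1)] x(2) by blast
    then show "cyclic_module R M" unfolding cyclic_module_def using x(1) by blast
  qed
  moreover have "submodule_covers R M \<noteq> {} \<and>
      covering_number R M =o min_card {carrier (R Quot \<mm>) |\<mm>. \<mm> \<in> ?S} +c cone" if S: "?S \<noteq> {}"
  proof
    let ?F = "{carrier (R Quot \<mm>) |\<mm>. \<mm> \<in> ?S}"
    have "?F \<noteq> {}" using S by blast
    from min_card[OF this] obtain \<mm> where m: "\<mm> \<in> ?S" "min_card ?F = |carrier (R Quot \<mm>)|"
      and le: "\<And>\<nn>. \<nn> \<in> ?S \<Longrightarrow> |carrier (R Quot \<mm>)| \<le>o |carrier (R Quot \<nn>)|" by blast
    obtain C where C: "C \<in> submodule_covers R M" "|C| \<le>o |carrier (R Quot \<mm>)| +c cone"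
      using noncyclic_imp_small_cover[OF m(1)] .
    show ne: "submodule_covers R M \<noteq> {}" using C(1) by blast
    from min_card[OF this] obtain D where D: "D \<in> submodule_covers R M" "covering_number R M = |D|"
      and Dle: "\<And>B. B \<in> submodule_covers R M \<Longrightarrow> |D| \<le>o |B|" unfolding covering_number_def by blast
    have "|D| \<le>o |carrier (R Quot \<mm>)| +c cone" by (rule ordLeq_transitive[OF Dle[OF C(1)] C(2)])
    moreover obtain \<nn> where n: "\<nn> \<in> ?S" "|carrier (R Quot \<nn>)| +c cone \<le>o |D|"
      using lower[OF D(1)] by blast
    have "|carrier (R Quot \<mm>)| +c cone \<le>o |D|"
      by (rule ordLeq_transitive[OF csum_mono1[OF le[OF n(1)]] n(2)])
    ultimately show "covering_number R M =o min_card ?F +c cone"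
      unfolding D(2) m(2) ordIso_iff_ordLeq by blast
  qed
  ultimately show ?thesis by blast
qed

end
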